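(* Let $\mathsf R$ and $\mathsf E$ be totally ordered finite sets with $|\mathsf R|=d\le n=|\mathsf E|$ and let $(M_\sigma)_{\sigma\in\binom{\mathsf E}{d}}$ be a polyhedral matching field. Let $\mathbb H$ be a hyperfield with the inflation property and let $A=(A_e)_{e\in\mathsf R\times\mathsf E}$ be an $\mathbb H$-matrix with no zero entries. Then the alternating function $\chi:\mathsf E^d\to\mathbb H$ given by $$\sigma\longmapsto \operatorname{sign}(M_\sigma)\otimes\bigotimes_{e\in M_\sigma}A_e$$ on $d$-subsets $\sigma$ of $\mathsf E$ is a weak matroid over $\mathbb H$.
   Context: **Polyhedral matching field.** $\triangle_{k-1}=\operatorname{conv}\{\mathbf e_1,\dots,\mathbf e_k\}\subset\mathbb R^k$. A triangulation of $\triangle_{d-1}\times\triangle_{n-1}$ is a collection of full-dimensional simplices with vertices among the vertices $(\mathbf e_i,\mathbf e_j)$, with union $\triangle_{d-1}\times\triangle_{n-1}$, any two intersecting in a common face. Identifying $\mathsf R\cong[d]$, $\mathsf E\cong[n]$ and $(\mathbf e_i,\mathbf e_j)$ with the edge $(i,j)$ of the complete bipartite graph $K_{\mathsf R,\mathsf E}$, each simplex becomes a spanning tree of $K_{\mathsf R,\mathsf E}$. For every $d$-subset $\sigma\subseteq\mathsf E$ there is exactly one perfect matching $M_\sigma$ between $\mathsf R$ and $\sigma$ contained in at least one of these trees; the family $(M_\sigma)$ is the polyhedral matching field of the triangulation. $\operatorname{sign}(M_\sigma)=\pm1$ is the sign of the permutation $[d]\to\mathsf R\to\sigma\to[d]$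 (order-preserving bijections at both ends, $M_\sigma$ in the middle), viewed as $1$ or $-1$ in $\mathbb H$. **Hyperfield.** A hyperfield $(\mathbb H,\boxplus,\otimes,0,1)$ is a set with elements $0\ne1$, a hyperoperation $\boxplus:\mathbb H\times\mathbb H\to 2^{\mathbb H}\setminus\{\emptyset\}$ and an operation $\otimes:\mathbb H\times\mathbb H\to\mathbb H$ such that: $x\boxplus y=y\boxplus x$; $\bigcup_{a\in x\boxplus y}a\boxplus z=\bigcup_{b\in y\boxplus z}x\boxplus b=:x\boxplus y\boxplus z$; $0\boxplus x=\{x\}$; for each $x$ there is a unique $-x$ with $0\in x\boxplus(-x)$; $x\in y\boxplus z$ iff $z\in x\boxplus(-y)$; $(\mathbb H\setminus\{0\},\otimes,1)$ is an abelian group and $0\otimes x=x\otimes0=0$; $a\otimes(x\boxplus y)=(a\otimes x)\boxplus(a\otimes y)$. $\mathbb H$ has the inflation property if $1\boxplus(-1)=\mathbb H$. **Weak matroid.** A weak matroid over $\mathbb H$ (on $\mathsf E$, of rank $d$) is given by a non-zero alternating function $\chi:\mathsf E^d\to\mathbb H$ such that $\{\sigma\in\binom{\mathsf E}{d}:\chi(\sigma)\ne0\}$ is the set of bases of a matroid and, for all $x_1,x_2,y_1,y_2\in\mathsf E$ and $X=\{x_3,\dots,x_d\}\subseteq\mathsf E$, $$0\in \chi(x_1,x_2,X)\chi(y_1,y_2,X)\boxplus\chi(x_1,y_1,X)\chi(y_2,x_2,X)\boxplus\chi(x_1,y_2,X)\chi(x_2,y_1,X),$$ where juxtaposition denotes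 $\otimes$. For $\sigma=\{\sigma_1<\dots<\sigma_d\}$, $\chi(\sigma):=\chi(\sigma_1,\dots,\sigma_d)$, which determines the alternating function $\chi$. *)

theory Defs
  imports
    "HOL-Analysis.Analysis"
    "HOL-Algebra.FiniteProduct"
    "HOL-Combinatorics.Permutations"
begin

section \<open>Hyperfields\<close>

record 'a hyperstructure = "'a monoid" +
  hzero :: 'a
  hadd :: "'a \<Rightarrow> 'a \<Rightarrow> 'a set"  (infixl \<open>\<boxplus>\<index>\<close> 65)

definition hneg :: "('a, 'm) hyperstructure_scheme \<Rightarrow> 'a \<Rightarrow> 'a"
  where "hneg H x = (THE y. y \<in> carrier H \<and> hzero H \<in> x \<boxplus>\<^bsub>H\<^esub> y)"

locale hyperfield =
  fixes H :: "('a, 'm) hyperstructure_scheme"  (structure)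
  assumes hzero_closed: "hzero H \<in> carrier H"
    and hzero_neq_one: "hzero H \<noteq> \<one>"
    and hadd_closed: "\<lbrakk>x \<in> carrier H; y \<in> carrier H\<rbrakk> \<Longrightarrow> x \<boxplus> y \<subseteq> carrier H"
    and hadd_nonempty: "\<lbrakk>x \<in> carrier H; y \<in> carrier H\<rbrakk> \<Longrightarrow> x \<boxplus> y \<noteq> {}"
    and hadd_commute: "\<lbrakk>x \<in> carrier H; y \<in> carrier H\<rbrakk> \<Longrightarrow> x \<boxplus> y = y \<boxplus> x"
    and hadd_assoc: "\<lbrakk>x \<in> carrier H; y \<in> carrier H; z \<in> carrier H\<rbrakk>
      \<Longrightarrow> (\<Union>a\<in>x \<boxplus> y. a \<boxplus> z) = (\<Union>b\<in>y \<boxplus> z. x \<boxplus> b)"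
    and hadd_hzero: "x \<in> carrier H \<Longrightarrow> hzero H \<boxplus> x = {x}"
    and hneg_unique: "x \<in> carrier H \<Longrightarrow> \<exists>!y. y \<in> carrier H \<and> hzero H \<in> x \<boxplus> y"
    and hadd_reversible: "\<lbrakk>x \<in> carrier H; y \<in> carrier H; z \<in> carrier H\<rbrakk>
      \<Longrightarrow> x \<in> y \<boxplus> z \<longleftrightarrow> z \<in> x \<boxplus> hneg H y"
    and units_comm_group: "comm_group (H\<lparr>carrier := carrier H - {hzero H}\<rparr>)"
    and hzero_mult: "x \<in> carrier H \<Longrightarrow> hzero H \<otimes> x = hzero H"
    and mult_hzero: "x \<in> carrier H \<Longrightarrow> x \<otimes> hzero H = hzero H"
    and hadd_distrib: "\<lbrakk>a \<in> carrier H; x \<in> carrier H; y \<in> carrier H\<rbrakk>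
      \<Longrightarrow> (\<lambda>b. a \<otimes> b) ` (x \<boxplus> y) = (a \<otimes> x) \<boxplus> (a \<otimes> y)"

definition inflation_property :: "('a, 'm) hyperstructure_scheme \<Rightarrow> bool"
  where "inflation_property H \<longleftrightarrow> \<one>\<^bsub>H\<^esub> \<boxplus>\<^bsub>H\<^esub> hneg H \<one>\<^bsub>H\<^esub> = carrier H"

definition hadd3 :: "('a, 'm) hyperstructure_scheme \<Rightarrow> 'a \<Rightarrow> 'a \<Rightarrow> 'a \<Rightarrow> 'a set"
  where "hadd3 H x y z = (\<Union>a\<in>x \<boxplus>\<^bsub>H\<^esub> y. a \<boxplus>\<^bsub>H\<^esub> z)"

definition hsign :: "('a, 'm) hyperstructure_scheme \<Rightarrow> (nat \<Rightarrow> nat) \<Rightarrow> 'a"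
  where "hsign H p = (if sign p = 1 then \<one>\<^bsub>H\<^esub> else hneg H \<one>\<^bsub>H\<^esub>)"


section \<open>Weak matroids over hyperfields\<close>

text \<open>
  The ground set is a finite linearly ordered type, and a function on \<open>d\<close>-tuples is a function
  on lists of which only the values at lists of length \<open>d\<close> matter.
\<close>

definition matroid_bases :: "'e::finite set set \<Rightarrow> bool"
  where "matroid_bases \<B> \<longleftrightarrow> \<B> \<noteq> {} \<and>
    (\<forall>B\<in>\<B>. \<forall>B'\<in>\<B>. \<forall>x\<in>B - B'. \<exists>y\<in>B' - B. insert y (B - {x}) \<in> \<B>)"

definition alternating ::
    "('a, 'm) hyperstructure_scheme \<Rightarrow> nat \<Rightarrow> ('e list \<Rightarrow> 'a) \<Rightarrow> bool"
  where "alternating H d chi \<longleftrightarrow> (\<forall>xs. length xs = d \<longrightarrow>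
    (\<not> distinct xs \<longrightarrow> chi xs = hzero H) \<and>
    (\<forall>p. p permutes {..<d} \<longrightarrow> chi (permute_list p xs) = hsign H p \<otimes>\<^bsub>H\<^esub> chi xs))"

definition weak_matroid ::
    "('a, 'm) hyperstructure_scheme \<Rightarrow> nat \<Rightarrow> ('e::{finite,linorder} list \<Rightarrow> 'a) \<Rightarrow> bool"
  where "weak_matroid H d chi \<longleftrightarrow>
    (\<forall>xs. length xs = d \<longrightarrow> chi xs \<in> carrier H) \<and>
    (\<exists>xs. length xs = d \<and> chi xs \<noteq> hzero H) \<and>
    alternating H d chi \<and>
    matroid_bases {\<sigma>. card \<sigma> = d \<and> chi (sorted_list_of_set \<sigma>) \<noteq> hzero H} \<and>
    (\<forall>x1 x2 y1 y2 X. length X + 2 = d \<longrightarrow>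
      hzero H \<in> hadd3 H
        (chi (x1 # x2 # X) \<otimes>\<^bsub>H\<^esub> chi (y1 # y2 # X))
        (chi (x1 # y1 # X) \<otimes>\<^bsub>H\<^esub> chi (y2 # x2 # X))
        (chi (x1 # y2 # X) \<otimes>\<^bsub>H\<^esub> chi (x2 # y1 # X)))"

text \<open>
  For a distinct list \<open>xs\<close> of length \<open>d\<close>, the permutation of \<open>{0..<d}\<close> sending \<open>k\<close> to the
  position of \<open>xs ! k\<close> in the increasing enumeration of \<open>set xs\<close>.
\<close>

definition rank_perm :: "'e::linorder list \<Rightarrow> nat \<Rightarrow> nat"
  where "rank_perm xs k =
    (if k < length xs
     then inv_into {..<length xs} (\<lambda>l. sorted_list_of_set (set xs) ! l) (xs ! k)
     else k)"

text \<open>The alternating function on tuples determined by its values \<open>f \<sigma>\<close> on subsets \<open>\<sigma>\<close>.\<close>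

definition alternating_extension ::
    "('a, 'm) hyperstructure_scheme \<Rightarrow> ('e::linorder set \<Rightarrow> 'a) \<Rightarrow> 'e list \<Rightarrow> 'a"
  where "alternating_extension H f xs =
    (if distinct xs then hsign H (rank_perm xs) \<otimes>\<^bsub>H\<^esub> f (set xs) else hzero H)"

lemma rank_perm_sorted:
  assumes "sorted xs" "distinct xs"
  shows "rank_perm xs = id"
proof
  fix k
  have "inj_on ((!) xs) {..<length xs}"
    using assms(2) by (simp add: inj_on_nth)
  then show "rank_perm xs k = id k"
    using assms by (simp add: rank_perm_def sorted_list_of_set.idem_if_sorted_distinct)
qed

lemma (in hyperfield) alternating_extension_sorted:
  assumes "finite \<sigma>" "f \<sigma> \<in> carrier H"
  shows "alternating_extension H f (sorted_list_of_set \<sigma>) = f \<sigma>"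
proof -
  interpret G: comm_group "H\<lparr>carrier := carrier H - {hzero H}\<rparr>"
    by (rule units_comm_group)
  have "\<one> \<otimes> x = x" if "x \<in> carrier H" for x
    using that G.l_one[of x] mult_hzero[of "\<one>"] G.one_closed by (cases "x = hzero H") auto
  with assms show ?thesis
    by (simp add: alternating_extension_def rank_perm_sorted hsign_def)
qed


section \<open>Polyhedral matching fields\<close>

definition vertex_simplex :: "(real ^ 'k::finite) set"
  where "vertex_simplex = convex hull (range (\<lambda>i. axis i 1))"

definition product_vertex :: "'r::finite \<times> 'e::finite \<Rightarrow> (real ^ 'r) \<times> (real ^ 'e)"
  where "product_vertex e = (axis (fst e) 1, axis (snd e) 1)"

definition product_triangulation :: "((real ^ 'r::finite) \<times> (real ^ 'e::finite)) set set \<Rightarrow> bool"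
  where "product_triangulation \<T> \<longleftrightarrow>
    triangulation \<T> \<and>
    (\<forall>T\<in>\<T>. (int CARD('r) - 1 + (int CARD('e) - 1)) simplex T \<and>
      {v. v extreme_point_of T} \<subseteq> range product_vertex) \<and>
    \<Union>\<T> = vertex_simplex \<times> vertex_simplex"

definition simplex_edges :: "((real ^ 'r::finite) \<times> (real ^ 'e::finite)) set \<Rightarrow> ('r \<times> 'e) set"
  where "simplex_edges T = {e. product_vertex e extreme_point_of T}"

definition perfect_matching :: "'e set \<Rightarrow> ('r \<times> 'e) set \<Rightarrow> bool"
  where "perfect_matching \<sigma> M \<longleftrightarrow> M \<subseteq> UNIV \<times> \<sigma> \<and>
    (\<forall>i. \<exists>!j. (i, j) \<in> M) \<and> (\<forall>j\<in>\<sigma>. \<exists>!i. (i, j) \<in> M)"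

text \<open>
  For a given triangulation and each \<open>d\<close>-subset \<open>\<sigma>\<close> exactly one matching has the property
  required of \<open>M \<sigma>\<close>; this is a theorem, so uniqueness is not part of the definition.
  The values of \<open>M\<close> at other sets are irrelevant.
\<close>

definition polyhedral_matching_field ::
    "('e::finite set \<Rightarrow> ('r::finite \<times> 'e) set) \<Rightarrow> bool"
  where "polyhedral_matching_field M \<longleftrightarrow>
    (\<exists>\<T> :: ((real ^ 'r) \<times> (real ^ 'e)) set set. product_triangulation \<T> \<and>
      (\<forall>\<sigma>. card \<sigma> = CARD('r) \<longrightarrow>
        perfect_matching \<sigma> (M \<sigma>) \<and> (\<exists>T\<in>\<T>. M \<sigma> \<subseteq> simplex_edges T)))"

text \<open>
  The list in the definition runs through the partners of the elements of \<open>'r\<close> in increasing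
  order, that is, it is the composite of the first two maps in \<open>[d] \<rightarrow> 'r \<rightarrow> \<sigma> \<rightarrow> [d]\<close>.
\<close>

definition matching_perm :: "('r::{finite,linorder} \<times> 'e::linorder) set \<Rightarrow> nat \<Rightarrow> nat"
  where "matching_perm M =
    rank_perm (map (\<lambda>i. THE j. (i, j) \<in> M) (sorted_list_of_set (UNIV :: 'r set)))"

end

theory Submission
  imports Defs
begin

text \<open>
  For four elements outside \<open>X\<close>, consider the point of the product of simplices whose coordinates are
  proportional to \<open>2\<close> on rows and on \<open>X\<close> and to \<open>1\<close> on the four elements. It lies in some simplex of the
  triangulation, whose edges form a forest, so it corresponds to a multigraph \<open>N\<close> with these degrees.
  Merging the four elements in two pairs makes \<open>N\<close> two-regular, hence a union of two perfect
  matchings, which belong to the matching field by uniqueness. The three ways of merging yield at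
  least two different splittings of the four elements, so two of the three terms of the
  Grassmann--Pluecker relation are products over the same multiset \<open>N\<close> of entries. Exchanging
  partners in \<open>N\<close> preserves the product of the two signs, which makes these two terms negatives of
  each other, and by inflation their sum contains the negative of the third term.
\<close>

section \<open>Hyperfields\<close>

text \<open>Inflation makes the size of the third term irrelevant, so the task is only to find two
  opposite terms. The degrees are forced: two matchings that share \<open>X\<close> and divide the
  four elements between them have a union with exactly these degrees. Integrality of the
  multiplicities is not chosen but follows from the forest, on which integral margins admit only
  integral weights.

  Merging the pairs ab and cd forbids the splitting ab|cd and hence produces one of the other two.
  Each of the three splittings is forbidden by one of the three mergings, so a single splitting
  cannot serve all of them.

  The obstacle is the signs: the four matchings in two splittings cover four different sets, and
  their permutations refer to four different enumerations. Writing the sets as tuples (a,c,X),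
  (b,d,X), (a,d,X), (b,c,X) gives \<open>a\<close> and \<open>b\<close> the first slot and
  \<open>c\<close> and \<open>d\<close> the second, so that all four matchings become permutations
  of the same slots. The sign of each tuple absorbs the order on \<open>'e\<close>.\<close>

context hyperfield
begin

section \<open>The multiplicative monoid\<close>

lemma mult_closed:
  assumes "x \<in> carrier H" "y \<in> carrier H"
  shows "x \<otimes> y \<in> carrier H"
proof -
  interpret G: comm_group "H\<lparr>carrier := carrier H - {hzero H}\<rparr>"
    by (rule units_comm_group)
  show ?thesis
    using assms G.m_closed[of x y] hzero_mult mult_hzero hzero_closed
    by (cases "x = hzero H \<or> y = hzero H") auto
qed

lemma mult_nonzero:
  assumes "x \<in> carrier H" "y \<in> carrier H" "x \<noteq> hzero H" "y \<noteq> hzero H"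
  shows "x \<otimes> y \<noteq> hzero H"
proof -
  interpret G: comm_group "H\<lparr>carrier := carrier H - {hzero H}\<rparr>"
    by (rule units_comm_group)
  show ?thesis
    using assms G.m_closed[of x y] by auto
qed

text \<open>The group laws are given only off zero. Adjoining zero yields the commutative monoid in
  which the finite products of matrix entries are taken.\<close>

lemma comm_monoid_mult: "comm_monoid H"
proof -
  interpret G: comm_group "H\<lparr>carrier := carrier H - {hzero H}\<rparr>"
    by (rule units_comm_group)
  have one: "\<one> \<in> carrier H"
    using G.one_closed by auto
  have comm: "x \<otimes> y = y \<otimes> x" if "x \<in> carrier H" "y \<in> carrier H" for x y
    using that G.m_comm[of x y] hzero_mult mult_hzero
    by (cases "x = hzero H \<or> y = hzero H") auto
  have assoc: "x \<otimes> y \<otimes> z = x \<otimes> (y \<otimes> z)"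
    if "x \<in> carrier H" "y \<in> carrier H" "z \<in> carrier H" for x y z
    using that G.m_assoc[of x y z] hzero_mult mult_hzero mult_closed
    by (cases "x = hzero H \<or> y = hzero H \<or> z = hzero H") auto
  have l_one: "\<one> \<otimes> x = x" if "x \<in> carrier H" for x
    using that G.l_one[of x] mult_hzero[OF one] by (cases "x = hzero H") auto
  show ?thesis
    using mult_closed one comm assoc l_one by (intro comm_monoidI)
qed

sublocale mult: comm_monoid H
  by (rule comm_monoid_mult)

text \<open>Inflation is postulated for 1 and -1 only; surjectivity of multiplication by a unit
  carries it to every nonzero \<open>x\<close>.\<close>

lemma units_surj:
  assumes "x \<in> carrier H" "x \<noteq> hzero H"
  shows "(\<otimes>) x ` carrier H = carrier H"
proof -
  interpret G: comm_group "H\<lparr>carrier := carrier H - {hzero H}\<rparr>"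
    by (rule units_comm_group)
  obtain y where y: "y \<in> carrier H" "x \<otimes> y = \<one>"
    using G.r_inv_ex[of x] assms by auto
  have "z \<in> (\<otimes>) x ` carrier H" if "z \<in> carrier H" for z
  proof
    show "z = x \<otimes> (y \<otimes> z)"
      using that y assms mult.m_assoc[of x y z] by simp
  qed (use that y mult_closed in auto)
  then show ?thesis
    using assms mult_closed by auto
qed

section \<open>The element -1 and cancellation\<close>

abbreviation minus_one :: 'a
  where "minus_one \<equiv> hneg H \<one>"

lemma minus_one_closed: "minus_one \<in> carrier H"
  and one_add_minus_one: "hzero H \<in> \<one> \<boxplus> minus_one"
  using theI'[OF hneg_unique[OF mult.one_closed]] unfolding hneg_def by auto

lemma minus_one_neq_hzero: "minus_one \<noteq> hzero H"
  using one_add_minus_one hadd_commute[OF mult.one_closed hzero_closed]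
    hadd_hzero[OF mult.one_closed] hzero_neq_one by auto

lemma hzero_in_add_minus:
  assumes "x \<in> carrier H"
  shows "hzero H \<in> x \<boxplus> (minus_one \<otimes> x)"
proof -
  have "x \<otimes> hzero H \<in> (x \<otimes> \<one>) \<boxplus> (x \<otimes> minus_one)"
    using hadd_distrib[OF assms mult.one_closed minus_one_closed] one_add_minus_one by blast
  then show ?thesis
    using assms mult_hzero minus_one_closed mult.m_comm by auto
qed

text \<open>Both 1 and the square of -1 are additive inverses of -1, and additive inverses are
  unique.\<close>

lemma minus_one_square: "minus_one \<otimes> minus_one = \<one>"
proof -
  have "hzero H \<in> minus_one \<boxplus> \<one>"
    using one_add_minus_one hadd_commute[OF mult.one_closed minus_one_closed] by simp
  moreover have "hzero H \<in> minus_one \<boxplus> (minus_one \<otimes> minus_one)"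
    using hzero_in_add_minus[OF minus_one_closed] .
  ultimately show ?thesis
    using hneg_unique[OF minus_one_closed] mult_closed minus_one_closed mult.one_closed by blast
qed

lemma minus_minus: "x \<in> carrier H \<Longrightarrow> minus_one \<otimes> (minus_one \<otimes> x) = x"
  using mult.m_assoc[OF minus_one_closed minus_one_closed] minus_one_square by simp

lemma add_minus_inflation:
  assumes "inflation_property H" "x \<in> carrier H" "x \<noteq> hzero H"
  shows "x \<boxplus> (minus_one \<otimes> x) = carrier H"
proof -
  have "(x \<otimes> \<one>) \<boxplus> (x \<otimes> minus_one) = (\<otimes>) x ` carrier H"
    using hadd_distrib[OF assms(2) mult.one_closed minus_one_closed] assms(1)
    by (simp add: inflation_property_def)
  then show ?thesis
    using assms(2) units_surj[OF assms(2,3)] mult.m_comm[OF assms(2) minus_one_closed] by simp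
qed

text \<open>Rotation brings any two of the three terms to the front, so it does not matter which two
  are opposite.\<close>

lemma hadd3_rotate:
  assumes "x \<in> carrier H" "y \<in> carrier H" "z \<in> carrier H"
  shows "hadd3 H x y z = hadd3 H y z x"
proof -
  have "(\<Union>b\<in>y \<boxplus> z. x \<boxplus> b) = (\<Union>b\<in>y \<boxplus> z. b \<boxplus> x)"
    using hadd_commute[OF assms(1)] hadd_closed[OF assms(2,3)] by blast
  then show ?thesis
    using hadd_assoc[OF assms] by (simp add: hadd3_def)
qed

text \<open>A vanishing \<open>z\<close> leaves ordinary cancellation; otherwise the sum of
  \<open>x\<close> and its negative is all of \<open>H\<close> and contains the negative of
  \<open>z\<close>. The last hypothesis excludes the bad case of zero \<open>x\<close> and nonzero
  \<open>z\<close>, where the sum is just {z}.\<close>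

lemma hzero_in_hadd3:
  assumes "inflation_property H" "x \<in> carrier H" "z \<in> carrier H"
    and "z = hzero H \<or> x \<noteq> hzero H"
  shows "hzero H \<in> hadd3 H x (minus_one \<otimes> x) z"
proof (cases "z = hzero H")
  case True
  then show ?thesis
    using hzero_in_add_minus[OF assms(2)] hadd_hzero[OF hzero_closed] by (force simp: hadd3_def)
next
  case False
  then have *: "x \<boxplus> (minus_one \<otimes> x) = carrier H"
    using assms add_minus_inflation by blast
  have "minus_one \<otimes> z \<in> carrier H"
    using assms(3) minus_one_closed mult_closed by blast
  moreover from this have "hzero H \<in> (minus_one \<otimes> z) \<boxplus> z"
    using hzero_in_add_minus[OF assms(3)] hadd_commute assms(3) by blast
  ultimately show ?thesis
    unfolding hadd3_def * by blast
qed

lemma hzero_in_hadd3_pairs: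
  assumes "inflation_property H" "x \<in> carrier H" "y \<in> carrier H" "z \<in> carrier H"
    and "y = minus_one \<otimes> x \<and> (z = hzero H \<or> x \<noteq> hzero H) \<or>
      z = minus_one \<otimes> y \<and> (x = hzero H \<or> y \<noteq> hzero H) \<or>
      x = minus_one \<otimes> z \<and> (y = hzero H \<or> z \<noteq> hzero H)"
  shows "hzero H \<in> hadd3 H x y z"
  using assms hzero_in_hadd3[of x z] hzero_in_hadd3[of y x] hzero_in_hadd3[of z y]
    hadd3_rotate[of x y z] hadd3_rotate[of y z x]
  by auto

lemma hsign_closed: "hsign H p \<in> carrier H"
  and hsign_neq_hzero: "hsign H p \<noteq> hzero H"
  using minus_one_closed minus_one_neq_hzero hzero_neq_one by (auto simp: hsign_def)

lemma hsign_mult: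
  assumes "sign r = sign p * sign q"
  shows "hsign H p \<otimes> hsign H q = hsign H r"
  using assms minus_one_square minus_one_closed
  by (cases p rule: sign_cases; cases q rule: sign_cases) (auto simp: hsign_def)

end

section \<open>Two-regular bipartite multigraphs and signs\<close>

lemma inj_on_insertI:
  "inj_on f A \<Longrightarrow> (\<And>z. z \<in> A \<Longrightarrow> f z \<noteq> f a) \<Longrightarrow> inj_on f (insert a A)"
  by (auto simp: inj_on_insert) (metis)

text \<open>
  In the induction step two elements \<open>x\<close>, \<open>y\<close> of a fibre of \<open>f\<close> are removed, and the remaining elements
  of their \<open>g\<close>-fibres are made a fibre of a modified \<open>g'\<close>.
\<close>

lemma halve_two_element_fibres:
  fixes f :: "'x \<Rightarrow> 'b" and g :: "'x \<Rightarrow> 'c"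
  assumes "finite S"
    and "\<And>x. x \<in> S \<Longrightarrow> \<exists>y. y \<noteq> x \<and> {z \<in> S. f z = f x} = {x, y}"
    and "\<And>x. x \<in> S \<Longrightarrow> \<exists>y. y \<noteq> x \<and> {z \<in> S. g z = g x} = {x, y}"
  shows "\<exists>C\<subseteq>S. inj_on f C \<and> inj_on f (S - C) \<and> inj_on g C \<and> inj_on g (S - C)"
  using assms
proof (induction "card S" arbitrary: S g rule: less_induct)
  case less
  show ?case
  proof (cases "S = {}")
    case False
    then obtain x where x: "x \<in> S"
      by blast
    obtain y where y: "y \<noteq> x" "{z \<in> S. f z = f x} = {x, y}"
      using less.prems(2)[OF x] by blast
    have yS: "y \<in> S" "f y = f x"
      using y by blast+
    define S' where "S' = S - {x, y}"
    have card: "card S' < card S" "finite S'"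
      using x less.prems(1) unfolding S'_def by (auto intro!: psubset_card_mono)
    have ffib: "\<exists>y. y \<noteq> z \<and> {w \<in> S'. f w = f z} = {z, y}" if z: "z \<in> S'" for z
    proof -
      have "f z \<noteq> f x"
        using z y unfolding S'_def by blast
      then have "{w \<in> S'. f w = f z} = {w \<in> S. f w = f z}"
        using yS unfolding S'_def by auto
      then show ?thesis
        using less.prems(2)[of z] z unfolding S'_def by auto
    qed
    have f_neq: "f z \<noteq> f x" if "z \<in> S'" for z
      using that y unfolding S'_def by blast
    obtain x' where x': "x' \<noteq> x" "{z \<in> S. g z = g x} = {x, x'}"
      using less.prems(3)[OF x] by blast
    obtain y' where y': "y' \<noteq> y" "{z \<in> S. g z = g y} = {y, y'}"
      using less.prems(3)[OF yS(1)] by blast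
    have x'_iff: "z \<in> S \<and> g z = g x \<longleftrightarrow> z = x \<or> z = x'" for z
      using eqset_imp_iff[OF x'(2), of z] by simp
    have y'_iff: "z \<in> S \<and> g z = g y \<longleftrightarrow> z = y \<or> z = y'" for z
      using eqset_imp_iff[OF y'(2), of z] by simp
    show ?thesis
    \<comment> \<open>The two pairings make \<open>S\<close> a disjoint union of even cycles, to be
      coloured alternately. If \<open>x\<close> and \<open>y\<close> also share a
      \<open>g\<close>-fibre, they are a cycle of their own and one goes into each half.\<close>
    proof (cases "g x = g y")
      case True
      then have x'y: "x' = y"
        using yS y(1) x'_iff[of y] by simp
      have g_neq: "g z \<noteq> g x" if "z \<in> S'" for z
        using that x'_iff[of z] x'y by (auto simp: S'_def)
      have "\<exists>y. y \<noteq> z \<and> {w \<in> S'. g w = g z} = {z, y}" if z: "z \<in> S'" for z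
      proof -
        have "{w \<in> S'. g w = g z} = {w \<in> S. g w = g z}"
          using g_neq[OF z] True unfolding S'_def by auto
        then show ?thesis
          using less.prems(3)[of z] z unfolding S'_def by auto
      qed
      then obtain C where C: "C \<subseteq> S'" "inj_on f C" "inj_on f (S' - C)" "inj_on g C" "inj_on g (S' - C)"
        using less.hyps[OF card ffib, where g = g] by blast
      have "x \<notin> C" "y \<notin> C"
        using C(1) unfolding S'_def by auto
      then have "S - insert x C = insert y (S' - C)" "insert x C \<subseteq> S"
        using C(1) x yS y(1) unfolding S'_def by auto
      moreover have "inj_on f (insert x C)" "inj_on f (insert y (S' - C))"
        "inj_on g (insert x C)" "inj_on g (insert y (S' - C))"
        using C f_neq g_neq yS(2) True by (auto simp: inj_on_insert) (metis subsetD)+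
      ultimately show ?thesis
        by (metis (no_types, lifting))
    next
      case False
      have x'S: "x' \<in> S'" "g x' = g x" and y'S: "y' \<in> S'" "g y' = g y"
        using x'(1) y'(1) x'_iff[of x'] y'_iff[of y'] False by (auto simp: S'_def)
      have x'y': "x' \<noteq> y'"
        using x'S y'S False by auto
      define g' where "g' = g(y' := g x)"
      have gx: "z = x'" if "z \<in> S'" "g z = g x" for z
        using that x'_iff[of z] by (simp add: S'_def)
      have gy: "z = y'" if "z \<in> S'" "g z = g y" for z
        using that y'_iff[of z] by (simp add: S'_def)
      have g'fib: "\<exists>y. y \<noteq> z \<and> {w \<in> S'. g' w = g' z} = {z, y}" if z: "z \<in> S'" for z
      proof (cases "z = x' \<or> z = y'")
        case True
        have "g' z = g x"
          using True x'S unfolding g'_def by auto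
        moreover have "w \<in> S' \<and> g' w = g x \<longleftrightarrow> w = x' \<or> w = y'" for w
          using gx[of w] x'S y'S by (cases "w = y'") (auto simp: g'_def)
        ultimately have "{w \<in> S'. g' w = g' z} = {x', y'}"
          by (simp add: set_eq_iff)
        then show ?thesis
          using True x'y' by (metis insert_commute)
      next
        case False
        then have neq: "g z \<noteq> g x" "g z \<noteq> g y"
          using gx[OF z] gy[OF z] by auto
        then have "w \<in> S' \<and> g' w = g' z \<longleftrightarrow> w \<in> S \<and> g w = g z" for w
          using False y'S by (cases "w = y'") (auto simp: S'_def g'_def)
        then have "{w \<in> S'. g' w = g' z} = {w \<in> S. g w = g z}"
          by (simp add: set_eq_iff)
        then show ?thesis
          using less.prems(3)[of z] z by (simp add: S'_def)
      qed
      obtain D where D: "D \<subseteq> S'" "inj_on f D" "inj_on f (S' - D)" "inj_on g' D" "inj_on g' (S' - D)"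
        using less.hyps[OF card ffib g'fib] by blast
      have g'x'y': "g' x' = g' y'"
        using x'S unfolding g'_def by auto
      then have one: "x' \<in> D \<longleftrightarrow> y' \<notin> D"
        using D x'S y'S x'y' by (metis DiffI inj_onD)
      \<comment> \<open>\<open>D\<close> separates the glued pair; up to complement,
        \<open>C\<close> contains \<open>x'\<close> and not \<open>y'\<close>. Then
        \<open>y\<close>, whose \<open>g\<close>-mate is \<open>y'\<close>, can join
        \<open>C\<close>, and \<open>x\<close>, whose \<open>g\<close>-mate is \<open>x'\<close>,
        can join the other half.\<close>
      obtain C where C: "C \<subseteq> S'" "inj_on f C" "inj_on f (S' - C)" "inj_on g' C" "inj_on g' (S' - C)"
        and x'C: "x' \<in> C" and y'C: "y' \<notin> C"
      proof (cases "x' \<in> D")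
        case True
        then show ?thesis
          using that[of D] D one by blast
      next
        case False
        moreover have "S' - (S' - D) = D"
          using D(1) by blast
        ultimately show ?thesis
          using that[of "S' - D"] D one x'S by auto
      qed
      have "x \<notin> C" "y \<notin> C"
        using C(1) unfolding S'_def by auto
      then have split: "S - insert y C = insert x (S' - C)" "insert y C \<subseteq> S"
        using C(1) x yS y(1) unfolding S'_def by auto
      have "inj_on g C"
        using C(4) y'C unfolding g'_def inj_on_def by (metis fun_upd_other)
      moreover have "g z \<noteq> g y" if "z \<in> C" for z
        using gy that y'C C(1) by blast
      ultimately have g1: "inj_on g (insert y C)"
        by (rule inj_on_insertI)
      have "inj_on g (S' - C)"
      proof (rule inj_onI)
        fix u v assume *: "u \<in> S' - C" "v \<in> S' - C" "g u = g v"
        then have "u = y' \<longleftrightarrow> v = y'"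
          using gy[of u] gy[of v] y'S(2) by (metis DiffD1)
        then have "g' u = g' v"
          using *(3) by (simp add: g'_def)
        then show "u = v"
          using inj_onD[OF C(5)] *(1,2) by blast
      qed
      moreover have "g z \<noteq> g x" if "z \<in> S' - C" for z
        using gx that x'C by blast
      ultimately have g2: "inj_on g (insert x (S' - C))"
        by (rule inj_on_insertI)
      have f_neq': "f z \<noteq> f y" if "z \<in> S'" for z
        using f_neq[OF that] yS(2) by simp
      have "inj_on f (insert y C)" "inj_on f (insert x (S' - C))"
        using inj_on_insertI[OF C(2) f_neq'[OF subsetD[OF C(1)]]]
          inj_on_insertI[OF C(3) f_neq[OF DiffD1[of _ S' C]]] by simp_all
      then show ?thesis
        using g1 g2 split by (intro exI[of _ "insert y C"]) simp
    qed
  qed auto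
qed

lemma permutation_of_permutes:
  fixes p :: "nat \<Rightarrow> nat"
  shows "p permutes {..<n} \<Longrightarrow> permutation p"
  using permutation_permutes by blast

text \<open>
  Both \<open>p1\<inverse> \<circ> q1\<close> and \<open>p2\<inverse> \<circ> q2\<close> fix the points where \<open>q1\<close> agrees with \<open>p1\<close>, and they are
  mutually inverse on the remaining points.
\<close>

lemma sign_mult_eq_of_exchange:
  fixes p1 p2 q1 q2 :: "nat \<Rightarrow> nat"
  assumes "p1 permutes {..<n}" "p2 permutes {..<n}" "q1 permutes {..<n}" "q2 permutes {..<n}"
    and ex: "\<And>k. q1 k = p1 k \<and> q2 k = p2 k \<or> q1 k = p2 k \<and> q2 k = p1 k"
  shows "sign p1 * sign p2 = sign q1 * sign q2"
proof -
  have perm: "permutation p1" "permutation p2" "permutation q1" "permutation q2"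
    using assms(1-4) by (simp_all add: permutation_of_permutes)
  have bij: "bij p1" "bij p2" "bij q1" "bij q2"
    using perm permutation_bijective by auto
  define \<gamma> where "\<gamma> = inv_into UNIV p1 \<circ> q1"
  define \<delta> where "\<delta> = inv_into UNIV p2 \<circ> q2"
  have p\<gamma>: "p1 (\<gamma> k) = q1 k" for k
    using bij by (simp add: \<gamma>_def bij_is_surj surj_f_inv_f)
  have p\<delta>: "p2 (\<delta> k) = q2 k" for k
    using bij by (simp add: \<delta>_def bij_is_surj surj_f_inv_f)
  have inj: "x = y" if "p1 x = p1 y \<or> p2 x = p2 y \<or> q1 x = q1 y \<or> q2 x = q2 y" for x y
    using that bij by (auto dest: bij_is_inj injD)
  have "\<delta> (\<gamma> k) = k" for k
    by (metis ex p\<gamma> p\<delta> inj)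
  then have "\<delta> \<circ> \<gamma> = id"
    by auto
  moreover have perm': "permutation \<gamma>" "permutation \<delta>"
    using perm by (simp_all add: \<gamma>_def \<delta>_def permutation_compose permutation_inverse)
  ultimately have "sign \<delta> * sign \<gamma> = 1"
    by (metis sign_compose sign_id)
  moreover have "q1 = p1 \<circ> \<gamma>" "q2 = p2 \<circ> \<delta>"
    using p\<gamma> p\<delta> by auto
  then have "sign q1 = sign p1 * sign \<gamma>" "sign q2 = sign p2 * sign \<delta>"
    using perm perm' by (simp_all add: sign_compose)
  ultimately show ?thesis
    by (simp add: algebra_simps)
qed

section \<open>Signs of tuples relative to the order of the ground set\<close>

lemma rank_perm_permutes:
  assumes "distinct xs"
  shows "rank_perm xs permutes {..<length xs}"
    and "\<And>k. k < length xs \<Longrightarrow> sorted_list_of_set (set xs) ! rank_perm xs k = xs ! k"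
proof -
  let ?s = "sorted_list_of_set (set xs)"
  have len: "length ?s = length xs"
    using assms by (simp add: distinct_card)
  have bs: "bij_betw ((!) ?s) {..<length xs} (set xs)"
    using len by (intro bij_betw_nth) auto
  have bx: "bij_betw ((!) xs) {..<length xs} (set xs)"
    using assms by (intro bij_betw_nth) auto
  have b: "bij_betw (inv_into {..<length xs} ((!) ?s) \<circ> (!) xs) {..<length xs} {..<length xs}"
    using bij_betw_trans[OF bx bij_betw_inv_into[OF bs]] .
  have "bij_betw (rank_perm xs) {..<length xs} {..<length xs}"
    by (rule iffD1[OF bij_betw_cong b]) (simp add: rank_perm_def)
  then show "rank_perm xs permutes {..<length xs}"
    by (rule bij_imp_permutes) (simp add: rank_perm_def)
  show "?s ! rank_perm xs k = xs ! k" if "k < length xs" for k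
    using that bs bij_betw_imp_surj_on[OF bs] by (auto simp: rank_perm_def intro!: f_inv_into_f)
qed

lemma rank_perm_unique:
  assumes "distinct xs" "k < length xs" "l < length xs" "sorted_list_of_set (set xs) ! l = xs ! k"
  shows "rank_perm xs k = l"
proof -
  have "rank_perm xs k < length xs"
    using permutes_in_image[OF rank_perm_permutes(1)[OF assms(1)], of k] assms(2) by simp
  moreover have "length (sorted_list_of_set (set xs)) = length xs"
    using assms(1) by (simp add: distinct_card)
  ultimately show ?thesis
    using rank_perm_permutes(2)[OF assms(1,2)] assms(3,4)
    by (metis distinct_sorted_list_of_set nth_eq_iff_index_eq)
qed

lemma sign_rank_perm_permute_list:
  assumes "distinct xs" "p permutes {..<length xs}"
  shows "sign (rank_perm (permute_list p xs)) = sign (rank_perm xs) * sign p"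
proof -
  have "rank_perm (permute_list p xs) k = (rank_perm xs \<circ> p) k" for k
  proof (cases "k < length xs")
    case True
    then have pk: "p k < length xs"
      using permutes_in_image[OF assms(2)] by simp
    then have "rank_perm xs (p k) < length xs"
      using permutes_in_image[OF rank_perm_permutes(1)[OF assms(1)]] by simp
    then show ?thesis
      using True assms rank_perm_permutes(2)[OF assms(1) pk]
      by (auto intro!: rank_perm_unique simp: permute_list_nth)
  next
    case False
    then show ?thesis
      using permutes_not_in[OF assms(2), of k] by (simp add: rank_perm_def)
  qed
  then have "rank_perm (permute_list p xs) = rank_perm xs \<circ> p"
    by auto
  moreover have "permutation (rank_perm xs)" "permutation p"
    using rank_perm_permutes(1)[OF assms(1)] assms(2) by (simp_all add: permutation_of_permutes)
  ultimately show ?thesis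
    by (simp add: sign_compose)
qed

text \<open>Since \<open>rank_perm ys\<close> is \<open>rank_perm xs\<close> after \<open>p\<close>,
  the sign of \<open>rank_perm xs\<close> occurs twice and cancels. \<open>pos\<close> is
  constrained only on the entries of \<open>xs\<close>, so that one function can serve tuples over
  different sets.\<close>

lemma sign_rank_perm_mult_rank_perm:
  assumes "distinct xs" "distinct ys" "set ys = set xs"
    and pos: "\<And>i. i < length xs \<Longrightarrow> pos (xs ! i) = i"
    and p_def: "\<And>k. p k = (if k < length xs then pos (ys ! k) else k)"
  shows "p permutes {..<length xs}"
    and "sign (rank_perm xs) * sign (rank_perm ys) = sign p"
proof -
  have len: "length ys = length xs"
    using assms(1-3) by (metis distinct_card)
  have p: "p k < length xs" "xs ! p k = ys ! k" if "k < length xs" for k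
  proof -
    have "ys ! k \<in> set xs"
      using that len assms(3) by (metis nth_mem)
    then obtain i where "i < length xs" "xs ! i = ys ! k"
      by (metis in_set_conv_nth)
    then show "p k < length xs" "xs ! p k = ys ! k"
      using that pos[of i] by (auto simp: p_def)
  qed
  have "inj_on p {..<length xs}"
    using p(2) assms(2) len by (auto simp: inj_on_def) (metis nth_eq_iff_index_eq)
  then have "bij_betw p {..<length xs} {..<length xs}"
    using p(1) by (intro bij_betw_imageI endo_inj_surj) auto
  then show perm: "p permutes {..<length xs}"
    by (rule bij_imp_permutes) (simp add: p_def)
  have "rank_perm ys k = (rank_perm xs \<circ> p) k" for k
  proof (cases "k < length xs")
    case True
    have "rank_perm xs (p k) < length xs"
      using permutes_in_image[OF rank_perm_permutes(1)[OF assms(1)]] p(1)[OF True] by simp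
    then show ?thesis
      using True assms(2,3) len p[OF True] rank_perm_permutes(2)[OF assms(1) p(1)[OF True]]
      by (auto intro!: rank_perm_unique)
  qed (use len in \<open>auto simp: rank_perm_def p_def\<close>)
  then have "rank_perm ys = rank_perm xs \<circ> p"
    by auto
  moreover have "permutation (rank_perm xs)" "permutation p"
    using rank_perm_permutes(1)[OF assms(1)] perm by (simp_all add: permutation_of_permutes)
  ultimately show "sign (rank_perm xs) * sign (rank_perm ys) = sign p"
    by (simp add: sign_compose)
qed

section \<open>Triangulations of products of simplices\<close>

lemma sum_edges_by_row: "(\<Sum>e\<in>UNIV. h e) = (\<Sum>i\<in>UNIV. \<Sum>j\<in>UNIV. h (i, j))"
  for h :: "'r::finite \<times> 'e::finite \<Rightarrow> 'c::comm_monoid_add"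
  by (simp add: sum.cartesian_product UNIV_Times_UNIV[symmetric] del: UNIV_Times_UNIV)

lemma sum_edges_by_column: "(\<Sum>e\<in>UNIV. h e) = (\<Sum>j\<in>UNIV. \<Sum>i\<in>UNIV. h (i, j))"
  for h :: "'r::finite \<times> 'e::finite \<Rightarrow> 'c::comm_monoid_add"
  unfolding sum_edges_by_row by (rule sum.swap)

lemma inj_product_vertex: "inj product_vertex"
  by (auto simp: inj_def product_vertex_def axis_eq_axis)

text \<open>The dictionary between geometry and graphs: linear relations between vertices of the
  product are edge weights with zero margins.\<close>

lemma sum_product_vertex:
  fixes f :: "'r::finite \<times> 'e::finite \<Rightarrow> real"
  shows "(\<Sum>e\<in>UNIV. f e *\<^sub>R product_vertex e) =
    ((\<chi> i. \<Sum>j\<in>UNIV. f (i, j)), (\<chi> j. \<Sum>i\<in>UNIV. f (i, j)))"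
proof (rule prod_eqI)
  have "(\<Sum>e\<in>UNIV. f e * (axis (fst e) 1 :: real ^ 'r) $ k) = (\<Sum>j\<in>UNIV. f (k, j))" for k
    unfolding sum_edges_by_column by (simp add: axis_def if_distrib cong: if_cong)
  then show "fst (\<Sum>e\<in>UNIV. f e *\<^sub>R product_vertex e) =
      fst ((\<chi> i. \<Sum>j\<in>UNIV. f (i, j)), (\<chi> j. \<Sum>i\<in>UNIV. f (i, j)))"
    by (simp add: vec_eq_iff fst_sum product_vertex_def)
  have "(\<Sum>e\<in>UNIV. f e * (axis (snd e) 1 :: real ^ 'e) $ k) = (\<Sum>i\<in>UNIV. f (i, k))" for k
    unfolding sum_edges_by_row by (simp add: axis_def if_distrib cong: if_cong)
  then show "snd (\<Sum>e\<in>UNIV. f e *\<^sub>R product_vertex e) =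
      snd ((\<chi> i. \<Sum>j\<in>UNIV. f (i, j)), (\<chi> j. \<Sum>i\<in>UNIV. f (i, j)))"
    by (simp add: vec_eq_iff snd_sum product_vertex_def)
qed

text \<open>This says that the bipartite graph with edge set \<open>G\<close> is a forest.\<close>

definition margin_independent :: "('r::finite \<times> 'e::finite) set \<Rightarrow> bool"
  where "margin_independent G \<longleftrightarrow> (\<forall>f :: 'r \<times> 'e \<Rightarrow> real.
    (\<forall>e. e \<notin> G \<longrightarrow> f e = 0) \<longrightarrow> (\<forall>i. (\<Sum>j\<in>UNIV. f (i, j)) = 0) \<longrightarrow>
    (\<forall>j. (\<Sum>i\<in>UNIV. f (i, j)) = 0) \<longrightarrow> (\<forall>e. f e = 0))"

lemma margin_independent_subset:
  "margin_independent G \<Longrightarrow> S \<subseteq> G \<Longrightarrow> margin_independent S"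
  unfolding margin_independent_def by blast

lemma margin_independent_eq:
  fixes f g :: "'r::finite \<times> 'e::finite \<Rightarrow> real"
  assumes "margin_independent G" "\<And>e. e \<notin> G \<Longrightarrow> f e = g e"
    and "\<And>i. (\<Sum>j\<in>UNIV. f (i, j)) = (\<Sum>j\<in>UNIV. g (i, j))"
    and "\<And>j. (\<Sum>i\<in>UNIV. f (i, j)) = (\<Sum>i\<in>UNIV. g (i, j))"
  shows "f = g"
proof
  fix e
  have "f e - g e = 0"
    using assms(1)[unfolded margin_independent_def, rule_format, of "\<lambda>e. f e - g e" e] assms(2-4)
    by (simp add: sum_subtractf)
  then show "f e = g e"
    by simp
qed

lemma double_card_image_le:
  assumes "finite S" "\<And>x. x \<in> S \<Longrightarrow> \<exists>y\<in>S. y \<noteq> x \<and> h y = h x"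
  shows "2 * card (h ` S) \<le> card S"
proof -
  have "card S = (\<Sum>c\<in>h ` S. card {x \<in> S. h x = c})"
    using sum.image_gen[OF assms(1), of "\<lambda>_. 1::nat" h] by simp
  also have "\<dots> \<ge> (\<Sum>c\<in>h ` S. 2)"
  proof (rule sum_mono)
    fix c assume "c \<in> h ` S"
    then obtain x y where "x \<in> S" "y \<in> S" "y \<noteq> x" "h x = c" "h y = c"
      using assms(2) by blast
    then have "card {x, y} \<le> card {x \<in> S. h x = c}"
      using assms(1) by (intro card_mono) auto
    then show "2 \<le> card {x \<in> S. h x = c}"
      using \<open>y \<noteq> x\<close> by simp
  qed
  finally show ?thesis
    by simp
qed

text \<open>The vectors of the edges lie in the hyperplane where row coordinates and column
  coordinates have equal sums. Adding one axis vector, which is off this hyperplane, keeps them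
  independent, and all of them lie in the span of the axis vectors of the vertices met by
  \<open>S\<close>. This gives the strict inequality.\<close>

lemma margin_independent_card:
  fixes S :: "('r::finite \<times> 'e::finite) set"
  assumes "margin_independent S" "S \<noteq> {}"
  shows "card S < card (fst ` S) + card (snd ` S)"
proof -
  define B :: "((real ^ 'r) \<times> (real ^ 'e)) set" where "B = product_vertex ` S"
  define V :: "((real ^ 'r) \<times> (real ^ 'e)) set"
    where "V = (\<lambda>i. (axis i 1, 0)) ` fst ` S \<union> (\<lambda>j. (0, axis j 1)) ` snd ` S"
  have "independent B"
  proof (rule ccontr)
    assume "\<not> independent B"
    moreover have "finite B"
      by (simp add: B_def)
    ultimately obtain u where u: "\<exists>v\<in>B. u v \<noteq> 0" "(\<Sum>v\<in>B. u v *\<^sub>R v) = 0"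
      by (auto simp: dependent_finite)
    define f where "f e = (if e \<in> S then u (product_vertex e) else 0)" for e
    have "(\<Sum>e\<in>UNIV. f e *\<^sub>R product_vertex e) = (\<Sum>e\<in>S. u (product_vertex e) *\<^sub>R product_vertex e)"
      by (rule sum.mono_neutral_cong_right) (auto simp: f_def)
    also have "\<dots> = (\<Sum>v\<in>B. u v *\<^sub>R v)"
      unfolding B_def by (subst sum.reindex) (auto intro: inj_on_subset[OF inj_product_vertex])
    finally have "(\<Sum>e\<in>UNIV. f e *\<^sub>R product_vertex e) = 0"
      using u by simp
    then have "f e = 0" for e
      using assms(1)[unfolded margin_independent_def, rule_format, of f]
      by (simp add: sum_product_vertex zero_prod_def vec_eq_iff f_def)
    then show False
      using u(1) unfolding B_def f_def by (metis imageE)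
  qed
  obtain i0 where i0: "i0 \<in> fst ` S"
    using assms(2) by blast
  define x0 :: "(real ^ 'r) \<times> (real ^ 'e)" where "x0 = (axis i0 1, 0)"
  let ?P = "{x :: (real ^ 'r) \<times> (real ^ 'e). (\<Sum>i\<in>UNIV. fst x $ i) = (\<Sum>j\<in>UNIV. snd x $ j)}"
  have "subspace ?P"
    by (simp add: subspace_def sum.distrib sum_distrib_left[symmetric])
  moreover have "B \<subseteq> ?P"
    by (auto simp: B_def product_vertex_def axis_def)
  ultimately have "span B \<subseteq> ?P"
    by (rule span_minimal[rotated])
  moreover have "x0 \<notin> ?P"
    by (simp add: x0_def axis_def)
  ultimately have x0: "x0 \<notin> span B"
    by blast
  then have "x0 \<notin> B"
    using span_base by blast
  have "product_vertex e \<in> span V" if "e \<in> S" for e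
  proof -
    have "product_vertex e = (axis (fst e) 1, 0) + (0, axis (snd e) 1)"
      by (simp add: product_vertex_def)
    moreover have "(axis (fst e) 1, 0) \<in> V" "(0, axis (snd e) 1) \<in> V"
      using that by (auto simp: V_def)
    ultimately show ?thesis
      by (metis span_add span_base)
  qed
  moreover have "x0 \<in> span V"
    using i0 by (auto simp: x0_def V_def intro: span_base)
  ultimately have "insert x0 B \<subseteq> span V"
    by (auto simp: B_def)
  moreover have "independent (insert x0 B)"
    using \<open>independent B\<close> x0 by (rule independent_insertI[rotated])
  moreover have "finite V"
    by (simp add: V_def)
  ultimately have "card (insert x0 B) \<le> card V"
    using independent_span_bound by blast
  moreover have "card (insert x0 B) = Suc (card S)"
    using \<open>x0 \<notin> B\<close> card_image[OF inj_on_subset[OF inj_product_vertex subset_UNIV], of S]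
    by (simp add: B_def)
  moreover have "card V \<le> card (fst ` S) + card (snd ` S)"
    unfolding V_def by (intro order_trans[OF card_Un_le] add_mono card_image_le) auto
  ultimately show ?thesis
    by simp
qed

text \<open>
  The non-integral entries would form a subgraph of minimum degree two, which has at least as many
  edges as vertices.
\<close>

lemma margin_independent_integral:
  fixes f :: "'r::finite \<times> 'e::finite \<Rightarrow> real"
  assumes "margin_independent G" "\<And>e. e \<notin> G \<Longrightarrow> f e = 0"
    and "\<And>i. (\<Sum>j\<in>UNIV. f (i, j)) \<in> \<int>" "\<And>j. (\<Sum>i\<in>UNIV. f (i, j)) \<in> \<int>"
  shows "f e \<in> \<int>"
proof (rule ccontr)
  assume "f e \<notin> \<int>"
  define S where "S = {e. f e \<notin> \<int>}"
  have "S \<subseteq> G"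
    using assms(2) by (auto simp: S_def) (metis Ints_0)
  then have "margin_independent S"
    using assms(1) margin_independent_subset by blast
  moreover have "S \<noteq> {}"
    using \<open>f e \<notin> \<int>\<close> unfolding S_def by blast
  ultimately have "card S < card (fst ` S) + card (snd ` S)"
    by (rule margin_independent_card)
  moreover have "2 * card (fst ` S) \<le> card S"
  proof (rule double_card_image_le)
    fix x assume x: "x \<in> S"
    obtain i j where ij: "x = (i, j)"
      by force
    have "\<exists>j'. j' \<noteq> j \<and> f (i, j') \<notin> \<int>"
    proof (rule ccontr)
      assume "\<nexists>j'. j' \<noteq> j \<and> f (i, j') \<notin> \<int>"
      then have "(\<Sum>j'\<in>UNIV - {j}. f (i, j')) \<in> \<int>"
        by (intro Ints_sum) auto
      then have "(\<Sum>j\<in>UNIV. f (i, j)) - (\<Sum>j'\<in>UNIV - {j}. f (i, j')) \<in> \<int>"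
        using assms(3) by (intro Ints_diff)
      then show False
        using x ij by (simp add: S_def sum.remove[of UNIV j "\<lambda>j. f (i, j)"])
    qed
    then show "\<exists>y\<in>S. y \<noteq> x \<and> fst y = fst x"
      by (auto simp: S_def ij)
  qed simp
  moreover have "2 * card (snd ` S) \<le> card S"
  proof (rule double_card_image_le)
    fix x assume x: "x \<in> S"
    obtain i j where ij: "x = (i, j)"
      by force
    have "\<exists>i'. i' \<noteq> i \<and> f (i', j) \<notin> \<int>"
    proof (rule ccontr)
      assume "\<nexists>i'. i' \<noteq> i \<and> f (i', j) \<notin> \<int>"
      then have "(\<Sum>i'\<in>UNIV - {i}. f (i', j)) \<in> \<int>"
        by (intro Ints_sum) auto
      then have "(\<Sum>i\<in>UNIV. f (i, j)) - (\<Sum>i'\<in>UNIV - {i}. f (i', j)) \<in> \<int>"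
        using assms(4) by (intro Ints_diff)
      then show False
        using x ij by (simp add: S_def sum.remove[of UNIV i "\<lambda>i. f (i, j)"])
    qed
    then show "\<exists>y\<in>S. y \<noteq> x \<and> snd y = snd x"
      by (auto simp: S_def ij)
  qed simp
  ultimately show False
    by simp
qed

section \<open>Simplices of the triangulation as forests\<close>

lemma simplex_edges_hull:
  fixes T :: "((real ^ 'r::finite) \<times> (real ^ 'e::finite)) set"
  assumes "n simplex T" "{v. v extreme_point_of T} \<subseteq> range product_vertex"
  shows "\<not> affine_dependent (product_vertex ` simplex_edges T)"
    and "T = convex hull (product_vertex ` simplex_edges T)"
proof -
  obtain C where C: "\<not> affine_dependent C" "T = convex hull C"
    using assms(1) by (auto simp: simplex_def)
  \<comment> \<open>Affine independence makes every point of \<open>C\<close> extreme in its hull,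
    so the edges of \<open>T\<close> recover \<open>C\<close> exactly.\<close>
  then have ext: "v extreme_point_of T \<longleftrightarrow> v \<in> C" for v
    using extreme_point_of_convex_hull_affine_independent by blast
  then have "C \<subseteq> range product_vertex"
    using assms(2) by auto
  then have "product_vertex ` simplex_edges T = C"
    using ext by (auto simp: simplex_edges_def)
  then show "\<not> affine_dependent (product_vertex ` simplex_edges T)"
    "T = convex hull (product_vertex ` simplex_edges T)"
    using C by auto
qed

text \<open>A weight with zero margins is a linear dependence between the vertices. Its total is the
  sum of its row sums, hence zero, so the dependence is affine, which a simplex does not
  allow.\<close>

lemma simplex_edges_margin_independent:
  fixes T :: "((real ^ 'r::finite) \<times> (real ^ 'e::finite)) set"
  assumes "n simplex T" "{v. v extreme_point_of T} \<subseteq> range product_vertex"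
  shows "margin_independent (simplex_edges T)"
  unfolding margin_independent_def
proof (intro allI impI, rule ccontr)
  fix f :: "'r \<times> 'e \<Rightarrow> real" and e0
  assume f: "\<forall>e. e \<notin> simplex_edges T \<longrightarrow> f e = 0" "\<forall>i. (\<Sum>j\<in>UNIV. f (i, j)) = 0"
    "\<forall>j. (\<Sum>i\<in>UNIV. f (i, j)) = 0" and e0: "f e0 \<noteq> 0"
  let ?E = "simplex_edges T"
  define U where "U v = f (inv_into UNIV product_vertex v)" for v
  have U: "U (product_vertex e) = f e" for e
    by (simp add: U_def inv_f_f inj_product_vertex)
  have inj: "inj_on product_vertex ?E"
    using inj_product_vertex inj_on_subset by blast
  have "sum U (product_vertex ` ?E) = (\<Sum>e\<in>?E. f e)"
    by (simp add: sum.reindex[OF inj] U)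
  also have "\<dots> = (\<Sum>e\<in>UNIV. f e)"
    using f(1) by (intro sum.mono_neutral_left) auto
  also have "\<dots> = 0"
    using f(2) by (simp add: sum_edges_by_row)
  finally have "sum U (product_vertex ` ?E) = 0" .
  moreover have "(\<Sum>v\<in>product_vertex ` ?E. U v *\<^sub>R v) = (\<Sum>e\<in>?E. f e *\<^sub>R product_vertex e)"
    by (simp add: sum.reindex[OF inj] U)
  then have "(\<Sum>v\<in>product_vertex ` ?E. U v *\<^sub>R v) = (\<Sum>e\<in>UNIV. f e *\<^sub>R product_vertex e)"
    using f(1) by (simp add: sum.mono_neutral_left[of UNIV ?E])
  then have "(\<Sum>v\<in>product_vertex ` ?E. U v *\<^sub>R v) = 0"
    using f(2,3) by (simp add: sum_product_vertex zero_prod_def vec_eq_iff)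
  moreover have "\<exists>v\<in>product_vertex ` ?E. U v \<noteq> 0"
    using e0 f(1) U by (metis image_eqI)
  ultimately have "affine_dependent (product_vertex ` ?E)"
    by (subst affine_dependent_explicit_finite) auto
  then show False
    using simplex_edges_hull(1)[OF assms] by blast
qed

text \<open>The weights are barycentric coordinates of \<open>x\<close>, extended by zero off the
  edges of \<open>T\<close>.\<close>

lemma simplex_point_weights:
  fixes T :: "((real ^ 'r::finite) \<times> (real ^ 'e::finite)) set"
  assumes "n simplex T" "{v. v extreme_point_of T} \<subseteq> range product_vertex" "x \<in> T"
  obtains f :: "'r \<times> 'e \<Rightarrow> real" where "\<And>e. 0 \<le> f e" "\<And>e. e \<notin> simplex_edges T \<Longrightarrow> f e = 0"
    "\<And>i. (\<Sum>j\<in>UNIV. f (i, j)) = fst x $ i" "\<And>j. (\<Sum>i\<in>UNIV. f (i, j)) = snd x $ j"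
proof -
  let ?E = "simplex_edges T"
  have inj: "inj_on product_vertex ?E"
    using inj_product_vertex inj_on_subset by blast
  have "x \<in> convex hull (product_vertex ` ?E)"
    using assms simplex_edges_hull(2) by blast
  then obtain u where u: "\<forall>v\<in>product_vertex ` ?E. 0 \<le> u v"
      "(\<Sum>v\<in>product_vertex ` ?E. u v *\<^sub>R v) = x"
    by (subst (asm) convex_hull_finite) auto
  define f where "f e = (if e \<in> ?E then u (product_vertex e) else 0)" for e
  have "(\<Sum>e\<in>UNIV. f e *\<^sub>R product_vertex e) = (\<Sum>e\<in>?E. u (product_vertex e) *\<^sub>R product_vertex e)"
    by (rule sum.mono_neutral_cong_right) (auto simp: f_def)
  then have "(\<Sum>e\<in>UNIV. f e *\<^sub>R product_vertex e) = x"
    using u(2) by (simp add: sum.reindex[OF inj])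
  then have "x = ((\<chi> i. \<Sum>j\<in>UNIV. f (i, j)), (\<chi> j. \<Sum>i\<in>UNIV. f (i, j)))"
    by (simp add: sum_product_vertex)
  then show thesis
    using u(1) by (intro that[of f]) (auto simp: f_def)
qed

lemma vertex_simplexI:
  fixes u :: "real ^ 'k::finite"
  assumes "\<And>i. 0 \<le> u $ i" "(\<Sum>i\<in>UNIV. u $ i) = 1"
  shows "u \<in> vertex_simplex"
proof -
  have "(\<Sum>i\<in>UNIV. u $ i *\<^sub>R axis i (1::real)) \<in> vertex_simplex"
    unfolding vertex_simplex_def using assms
    by (intro convex_sum) (auto intro: hull_inc)
  moreover have "(\<Sum>i\<in>UNIV. u $ i *\<^sub>R axis i (1::real)) = u"
    by (simp add: vec_eq_iff axis_def if_distrib cong: if_cong)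
  ultimately show ?thesis
    by simp
qed

section \<open>Splitting a multigraph into two matchings\<close>

lemma card_tokens:
  fixes N :: "'x::finite \<Rightarrow> nat"
  shows "card {z \<in> Sigma UNIV (\<lambda>e. {..<N e}). P (fst z)} = (\<Sum>e | P e. N e)"
proof -
  have "{z \<in> Sigma UNIV (\<lambda>e. {..<N e}). P (fst z)} = Sigma {e. P e} (\<lambda>e. {..<N e})"
    by auto
  then show ?thesis
    by (simp add: card_SigmaI)
qed

text \<open>
  The two-element fibres are those of the multiset of edges in which \<open>e\<close> occurs \<open>N e\<close> times; its
  elements are represented by the pairs \<open>(e, k)\<close> with \<open>k < N e\<close>.
\<close>

lemma two_regular_split:
  fixes N :: "'r::finite \<times> 'e::finite \<Rightarrow> nat" and mg :: "'e \<Rightarrow> 'c"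
  assumes rows: "\<And>i. (\<Sum>e | fst e = i. N e) = 2"
    and cols: "\<And>e. N e \<noteq> 0 \<Longrightarrow> (\<Sum>e' | mg (snd e') = mg (snd e). N e') = 2"
  obtains p q :: "'r \<Rightarrow> 'e" where "\<And>i j. N (i, j) = of_bool (p i = j) + of_bool (q i = j)"
    "inj (mg \<circ> p)" "inj (mg \<circ> q)"
proof -
  define S where "S = Sigma UNIV (\<lambda>e. {..<N e})"
  define f :: "('r \<times> 'e) \<times> nat \<Rightarrow> 'r" where "f z = fst (fst z)" for z
  define g :: "('r \<times> 'e) \<times> nat \<Rightarrow> 'c" where "g z = mg (snd (fst z))" for z
  have two: "\<exists>y. y \<noteq> x \<and> F = {x, y}" if "card F = 2" "x \<in> F" for F and x :: "('r \<times> 'e) \<times> nat"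
  proof -
    obtain u v where "F = {u, v}" "u \<noteq> v"
      using \<open>card F = 2\<close> by (meson card_2_iff)
    then show ?thesis
      using \<open>x \<in> F\<close> by (metis insertE insert_commute singletonD)
  qed
  have fS: "card {z \<in> S. f z = i} = 2" for i
    using card_tokens[of N "\<lambda>e. fst e = i"] rows by (simp add: S_def f_def)
  have gS: "card {z \<in> S. g z = g x} = 2" if "x \<in> S" for x
  proof -
    have "N (fst x) \<noteq> 0"
      using that by (auto simp: S_def)
    then show ?thesis
      using card_tokens[of N "\<lambda>e. mg (snd e) = g x"] cols by (simp add: S_def g_def)
  qed
  have "finite S"
    by (simp add: S_def)
  moreover have "\<exists>y. y \<noteq> x \<and> {z \<in> S. f z = f x} = {x, y}" if "x \<in> S" for x
    using two[OF fS] that by simp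
  moreover have "\<exists>y. y \<noteq> x \<and> {z \<in> S. g z = g x} = {x, y}" if "x \<in> S" for x
    using two[OF gS[OF that]] that by simp
  ultimately obtain C where C: "C \<subseteq> S" "inj_on f C" "inj_on f (S - C)" "inj_on g C" "inj_on g (S - C)"
    using halve_two_element_fibres[of S f g] by blast
  \<comment> \<open>A row fibre has two elements and \<open>f\<close> is injective on both halves,
    so each half contains exactly one of them: the halves are graphs of functions on the
    rows.\<close>
  have "\<exists>s t. s \<in> C \<and> t \<in> S - C \<and> {z \<in> S. f z = i} = {s, t}" for i
  proof -
    obtain s t where st: "{z \<in> S. f z = i} = {s, t}" "s \<noteq> t"
      using fS[of i] by (meson card_2_iff)
    then have "s \<in> {z \<in> S. f z = i}" "t \<in> {z \<in> S. f z = i}"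
      by simp_all
    then have "s \<in> S" "t \<in> S" "f s = f t"
      by simp_all
    moreover from this have "s \<in> C \<longleftrightarrow> t \<notin> C"
      using st(2) C(2,3) by (metis DiffI inj_onD)
    ultimately show ?thesis
      using st(1) by (cases "s \<in> C") (intro exI[of _ s] exI[of _ t], simp,
        intro exI[of _ t] exI[of _ s], simp add: insert_commute)
  qed
  then have "\<forall>i. \<exists>s t. s \<in> C \<and> t \<in> S - C \<and> {z \<in> S. f z = i} = {s, t}" ..
  from choice[OF this] obtain s
    where "\<forall>i. \<exists>t. s i \<in> C \<and> t \<in> S - C \<and> {z \<in> S. f z = i} = {s i, t}" ..
  from choice[OF this] obtain t
    where *: "\<forall>i. s i \<in> C \<and> t i \<in> S - C \<and> {z \<in> S. f z = i} = {s i, t i}" ..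
  have st: "s i \<in> C" "t i \<in> S - C" "{z \<in> S. f z = i} = {s i, t i}" for i
    using spec[OF *, of i] by simp_all
  have "s i \<in> {z \<in> S. f z = i}" "t i \<in> {z \<in> S. f z = i}" for i
    unfolding st(3) by simp_all
  then have fst_st: "f (s i) = i" "f (t i) = i" for i
    by simp_all
  define p where "p i = snd (fst (s i))" for i
  define q where "q i = snd (fst (t i))" for i
  have "N (i, j) = of_bool (p i = j) + of_bool (q i = j)" for i j
  proof -
    have "N (i, j) = card {z \<in> S. fst z = (i, j)}"
      using card_tokens[of N "\<lambda>e. e = (i, j)"] by (simp add: S_def)
    also have "{z \<in> S. fst z = (i, j)} = {z \<in> {s i, t i}. snd (fst z) = j}"
      unfolding st(3)[symmetric] by (auto simp: f_def)
    also have "card \<dots> = of_bool (p i = j) + of_bool (q i = j)"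
    proof -
      have "s i \<noteq> t i"
        using st(1,2) by (metis DiffD2)
      moreover have "{z \<in> {s i, t i}. P z} =
          (if P (s i) then {s i} else {}) \<union> (if P (t i) then {t i} else {})" for P
        by auto
      then have "{z \<in> {s i, t i}. snd (fst z) = j} =
          (if p i = j then {s i} else {}) \<union> (if q i = j then {t i} else {})"
        unfolding p_def q_def .
      ultimately show ?thesis
        by auto
    qed
    finally show ?thesis .
  qed
  moreover have "inj (mg \<circ> p)"
  proof (rule injI)
    fix x y assume "(mg \<circ> p) x = (mg \<circ> p) y"
    then have "g (s x) = g (s y)"
      by (simp add: p_def g_def)
    then have "s x = s y"
      by (rule inj_onD[OF C(4) _ st(1) st(1)])
    then show "x = y"
      using fst_st(1) by metis
  qed
  moreover have "inj (mg \<circ> q)"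
  proof (rule injI)
    fix x y assume "(mg \<circ> q) x = (mg \<circ> q) y"
    then have "g (t x) = g (t y)"
      by (simp add: q_def g_def)
    then have "t x = t y"
      by (rule inj_onD[OF C(5) _ st(2) st(2)])
    then show "x = y"
      using fst_st(2) by metis
  qed
  ultimately show thesis
    by (rule that)
qed

lemma sum_of_bool_inj:
  fixes p :: "'r::finite \<Rightarrow> 'e"
  assumes "inj p"
  shows "(\<Sum>i\<in>UNIV. of_bool (p i = a)) = (of_bool (a \<in> range p) :: nat)"
proof (cases "a \<in> range p")
  case True
  then obtain i0 where "p i0 = a"
    by blast
  then have "p i = a \<longleftrightarrow> i = i0" for i
    using assms by (auto dest: injD)
  then show ?thesis
    using True by simp
qed auto

lemma union_pairs_eq:
  assumes "R \<subseteq> {a, b, c, d} \<union> X" "X \<subseteq> R" "a \<in> R \<longleftrightarrow> b \<notin> R" "c \<in> R \<longleftrightarrow> d \<notin> R"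
  shows "R = {if a \<in> R then a else b, if c \<in> R then c else d} \<union> X"
proof (rule subset_antisym)
  show "R \<subseteq> {if a \<in> R then a else b, if c \<in> R then c else d} \<union> X"
  proof
    fix x
    assume "x \<in> R"
    moreover from this have "x = a \<or> x = b \<or> x = c \<or> x = d \<or> x \<in> X"
      using assms(1) by auto
    ultimately show "x \<in> {if a \<in> R then a else b, if c \<in> R then c else d} \<union> X"
      using assms(3,4) by fastforce
  qed
  show "{if a \<in> R then a else b, if c \<in> R then c else d} \<union> X \<subseteq> R"
    using assms(2-4) by simp
qed

text \<open>
  Merging \<open>b\<close> into \<open>a\<close> and \<open>d\<close> into \<open>c\<close> makes the multigraph two-regular.
\<close>

lemma split_merged:
  fixes N :: "'r::finite \<times> 'e::finite \<Rightarrow> nat"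
  assumes card: "card X + 2 = CARD('r)"
    and distinct: "distinct [a, b, c, d]" "{a, b, c, d} \<inter> X = {}"
    and rows: "\<And>i. (\<Sum>j\<in>UNIV. N (i, j)) = 2"
    and cols: "\<And>j. (\<Sum>i\<in>UNIV. N (i, j)) = (if j \<in> X then 2 else if j \<in> {a, b, c, d} then 1 else 0)"
  obtains p q :: "'r \<Rightarrow> 'e" where "\<And>i j. N (i, j) = of_bool (p i = j) + of_bool (q i = j)"
    "inj p" "inj q"
    "range p = {a, c} \<union> X \<and> range q = {b, d} \<union> X \<or> range p = {a, d} \<union> X \<and> range q = {b, c} \<union> X"
proof -
  define mg where "mg j = (if j = b then a else if j = d then c else j)" for j
  have rows': "(\<Sum>e | fst e = i. N e) = 2" for i
  proof -
    have "{e. fst e = i} = Pair i ` (UNIV :: 'e set)"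
      by auto
    then show ?thesis
      using rows[of i] by (simp add: sum.reindex inj_on_def)
  qed
  have cols': "(\<Sum>e | mg (snd e) = l. N e) = (\<Sum>j | mg j = l. \<Sum>i\<in>UNIV. N (i, j))" for l
  proof -
    have "{e. mg (snd e) = l} = (UNIV :: 'r set) \<times> {j. mg j = l}"
      by auto
    then have "(\<Sum>e | mg (snd e) = l. N e) = (\<Sum>i\<in>UNIV. \<Sum>j | mg j = l. N (i, j))"
      by (simp add: sum.cartesian_product)
    also have "\<dots> = (\<Sum>j | mg j = l. \<Sum>i\<in>UNIV. N (i, j))"
      by (rule sum.swap)
    finally show ?thesis .
  qed
  have support: "j \<in> {a, b, c, d} \<union> X" if "N (i, j) \<noteq> 0" for i j
  proof (rule ccontr)
    assume "j \<notin> {a, b, c, d} \<union> X"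
    then have "(\<Sum>i\<in>UNIV. N (i, j)) = 0"
      using cols[of j] by auto
    then show False
      using that by simp
  qed
  \<comment> \<open>A merged pair of columns has degree 1 + 1, and a column of \<open>X\<close>
    keeps its degree 2.\<close>
  have "(\<Sum>e' | mg (snd e') = mg (snd e). N e') = 2" if "N e \<noteq> 0" for e
  proof -
    have "snd e \<in> {a, b, c, d} \<union> X"
      using support[of "fst e" "snd e"] that by simp
    then consider "snd e \<in> {a, b}" | "snd e \<in> {c, d}" | "snd e \<in> X"
      by blast
    then show ?thesis
    proof cases
      case 1
      then have "mg (snd e) = a"
        using distinct by (auto simp: mg_def)
      moreover have "{j. mg j = a} = {a, b}"
        using distinct by (auto simp: mg_def)
      ultimately show ?thesis
        using distinct cols by (simp add: cols')
    next
      case 2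
      then have "mg (snd e) = c"
        using distinct by (auto simp: mg_def)
      moreover have "{j. mg j = c} = {c, d}"
        using distinct by (auto simp: mg_def)
      ultimately show ?thesis
        using distinct cols by (simp add: cols')
    next
      case 3
      then have "{j. mg j = mg (snd e)} = {snd e}"
        using distinct by (auto simp: mg_def)
      then show ?thesis
        using 3 cols by (simp add: cols')
    qed
  qed
  then obtain p q :: "'r \<Rightarrow> 'e"
    where pq: "\<And>i j. N (i, j) = of_bool (p i = j) + of_bool (q i = j)" "inj (mg \<circ> p)" "inj (mg \<circ> q)"
    using two_regular_split[of N mg] rows' by blast
  have inj: "inj p" "inj q"
    using pq(2,3) by (auto intro: inj_on_imageI2)
  have "p i \<in> {a, b, c, d} \<union> X" "q i \<in> {a, b, c, d} \<union> X" for i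
    using support[of i "p i"] support[of i "q i"] pq(1) by auto
  then have sub: "range p \<subseteq> {a, b, c, d} \<union> X" "range q \<subseteq> {a, b, c, d} \<union> X"
    by auto
  \<comment> \<open>The injective map \<open>mg \<circ> r\<close> takes values in the set of
    \<open>a\<close>, \<open>c\<close> and \<open>X\<close>, which has as many elements as there are
    rows, so it is onto. Hence \<open>r\<close> hits all of \<open>X\<close> and exactly one element
    of each merged pair.\<close>
  have covers: "range r = {if a \<in> range r then a else b, if c \<in> range r then c else d} \<union> X"
    if "inj (mg \<circ> r)" "range r \<subseteq> {a, b, c, d} \<union> X" for r :: "'r \<Rightarrow> 'e"
  proof -
    have "range (mg \<circ> r) \<subseteq> {a, c} \<union> X"
      using that(2) distinct by (auto simp: mg_def)
    moreover have "card (range (mg \<circ> r)) = CARD('r)"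
      using card_image[OF that(1)] .
    moreover have "card ({a, c} \<union> X) = CARD('r)"
      using card distinct by (subst card_Un_disjoint) auto
    ultimately have full: "range (mg \<circ> r) = {a, c} \<union> X"
      by (intro card_subset_eq) auto
    have X: "x \<in> range r" if "x \<in> X" for x
    proof -
      have "x \<in> range (mg \<circ> r)"
        unfolding full using that by simp
      then obtain i where i: "mg (r i) = x"
        by auto
      then have "r i = x"
        using that distinct by (auto simp: mg_def split: if_splits)
      then show ?thesis
        by blast
    qed
    have ab: "a \<in> range r \<or> b \<in> range r"
    proof -
      have "a \<in> range (mg \<circ> r)"
        unfolding full by simp
      then obtain i where "mg (r i) = a"
        by auto
      then have "r i = a \<or> r i = b"
        using distinct by (auto simp: mg_def split: if_splits)
      then show ?thesis
        by auto
    qed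
    have cd: "c \<in> range r \<or> d \<in> range r"
    proof -
      have "c \<in> range (mg \<circ> r)"
        unfolding full by simp
      then obtain i where "mg (r i) = c"
        by auto
      then have "r i = c \<or> r i = d"
        using distinct by (auto simp: mg_def split: if_splits)
      then show ?thesis
        by auto
    qed
    have "mg a = mg b" "mg c = mg d"
      using distinct by (auto simp: mg_def)
    have disj: "\<not> (u \<in> range r \<and> v \<in> range r)" if "mg u = mg v" "u \<noteq> v" for u v
      using that \<open>inj (mg \<circ> r)\<close> by (metis comp_apply injD imageE)
    have excl: "\<not> (a \<in> range r \<and> b \<in> range r)" "\<not> (c \<in> range r \<and> d \<in> range r)"
      using disj[of a b] disj[of c d] \<open>mg a = mg b\<close> \<open>mg c = mg d\<close> distinct by simp_all
    have "X \<subseteq> range r"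
      using X by (rule subsetI)
    moreover have "a \<in> range r \<longleftrightarrow> b \<notin> range r" "c \<in> range r \<longleftrightarrow> d \<notin> range r"
      using ab cd excl by argo+
    ultimately show ?thesis
      by (rule union_pairs_eq[OF \<open>range r \<subseteq> {a, b, c, d} \<union> X\<close>])
  qed
  \<comment> \<open>Column degree one means that each of the four elements is hit by exactly one of
    \<open>p\<close> and \<open>q\<close>, so \<open>q\<close> makes the choices opposite to those
    of \<open>p\<close>.\<close>
  have "(of_bool (j \<in> range p) + of_bool (j \<in> range q) :: nat) = (\<Sum>i\<in>UNIV. N (i, j))" for j
    by (simp only: pq(1) sum.distrib sum_of_bool_inj[OF inj(1)] sum_of_bool_inj[OF inj(2)])
  then have one: "(of_bool (j \<in> range p) + of_bool (j \<in> range q) :: nat) = 1" if "j \<in> {a, b, c, d}" for j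
    using cols[of j] that distinct by auto
  define \<alpha> \<gamma> where "\<alpha> \<longleftrightarrow> a \<in> range p" and "\<gamma> \<longleftrightarrow> c \<in> range p"
  have "\<alpha> \<longleftrightarrow> a \<notin> range q" "\<gamma> \<longleftrightarrow> c \<notin> range q"
    unfolding \<alpha>_def \<gamma>_def using one[of a] one[of c]
    by (cases "a \<in> range p"; cases "a \<in> range q"; cases "c \<in> range p"; cases "c \<in> range q"; simp)+
  then have "(if a \<in> range q then a else b) = (if \<alpha> then b else a)"
    "(if c \<in> range q then c else d) = (if \<gamma> then d else c)"
    by simp_all
  then have "range q = {if \<alpha> then b else a, if \<gamma> then d else c} \<union> X"
    using covers[OF pq(3) sub(2)] by (simp only:)
  moreover have "range p = {if \<alpha> then a else b, if \<gamma> then c else d} \<union> X"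
    using covers[OF pq(2) sub(1)] by (simp only: \<alpha>_def \<gamma>_def)
  \<comment> \<open>The four choices give two splittings, each with its two orders of
    \<open>p\<close> and \<open>q\<close>.\<close>
  ultimately have "range p = {a, c} \<union> X \<and> range q = {b, d} \<union> X \<or> range p = {a, d} \<union> X \<and> range q = {b, c} \<union> X \<or>
    range q = {a, c} \<union> X \<and> range p = {b, d} \<union> X \<or> range q = {a, d} \<union> X \<and> range p = {b, c} \<union> X"
    by (cases \<alpha>; cases \<gamma>) simp_all
  then show thesis
    using that[of p q] that[of q p] pq(1) inj by (auto simp: add.commute)
qed

section \<open>Uniqueness of matchings across the simplices\<close>

lemma barycentre_in_face:
  fixes v :: "'k \<Rightarrow> 'x::euclidean_space"
  assumes "F face_of S" "convex S" "finite I" "\<And>k. k \<in> I \<Longrightarrow> v k \<in> S"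
    and "(\<Sum>k\<in>I. (1 / real (card I)) *\<^sub>R v k) \<in> F" "i \<in> I"
  shows "v i \<in> F"
proof (cases "I = {i}")
  case True
  then show ?thesis
    using assms(5) by simp
next
  case False
  define n where "n = real (card (I - {i}))"
  have "I - {i} \<noteq> {}"
    using False assms(6) by blast
  then have n: "n > 0" "real (card I) = n + 1"
    using assms(3) card.remove[OF assms(3,6)] by (simp_all add: n_def card_gt_0_iff)
  \<comment> \<open>The full barycentre lies on the segment from \<open>v i\<close> to the
    barycentre \<open>w\<close> of the other points, and inside it unless \<open>v i = w\<close>. A
    face that meets the open segment contains both ends.\<close>
  define w where "w = (\<Sum>k\<in>I - {i}. (1 / n) *\<^sub>R v k)"
  have "w \<in> S"
  proof -
    have "(\<Sum>k\<in>I - {i}. 1 / n) = n * (1 / n)"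
      by (simp add: n_def)
    then have sum_one: "(\<Sum>k\<in>I - {i}. 1 / n) = 1"
      using n(1) by simp
    show ?thesis
      unfolding w_def by (rule convex_sum[OF _ assms(2) sum_one]) (use assms(3,4) n(1) in auto)
  qed
  let ?x = "(1 / (n + 1)) *\<^sub>R v i + (n / (n + 1)) *\<^sub>R w"
  have "(n / (n + 1)) *\<^sub>R w = (\<Sum>k\<in>I - {i}. (1 / (n + 1)) *\<^sub>R v k)"
    using n by (simp add: w_def scaleR_sum_right)
  then have x: "?x \<in> F"
    using assms(3,5,6) n by (simp add: sum.remove)
  show ?thesis
  proof (cases "v i = w")
    case True
    have "1 / (n + 1) + n / (n + 1) = 1"
      using n by (simp add: field_simps)
    then have "?x = w"
      unfolding True by (simp add: scaleR_add_left[symmetric])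
    then show ?thesis
      using x True by simp
  next
    case False
    have "1 - n / (n + 1) = 1 / (n + 1)"
      using n by (simp add: field_simps)
    then have "?x \<in> open_segment (v i) w"
      using False n by (auto simp: in_segment intro!: exI[of _ "n / (n + 1)"])
    then show ?thesis
      using face_ofD[OF assms(1) _ assms(4)[OF assms(6)] \<open>w \<in> S\<close> x] by blast
  qed
qed

text \<open>
  Both matchings have the same barycentre, which lies in the common face of the two simplices;
  this face contains all vertices of both matchings, and its vertices are affinely independent.
\<close>

lemma matching_in_simplices_unique:
  fixes \<T> :: "((real ^ 'r::finite) \<times> (real ^ 'e::finite)) set set" and p q :: "'r \<Rightarrow> 'e"
  assumes "product_triangulation \<T>" "T \<in> \<T>" "T' \<in> \<T>"
    and p: "inj p" "\<And>i. (i, p i) \<in> simplex_edges T"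
    and q: "inj q" "\<And>i. (i, q i) \<in> simplex_edges T'" "range q = range p"
  shows "p = q"
proof -
  define pt :: "('r \<Rightarrow> 'e) \<Rightarrow> (real ^ 'r) \<times> (real ^ 'e)"
    where "pt r = (\<Sum>i\<in>UNIV. (1 / real CARD('r)) *\<^sub>R product_vertex (i, r i))" for r
  have tri: "T \<inter> T' face_of T" "T \<inter> T' face_of T'"
    using assms(1-3) unfolding product_triangulation_def triangulation_def by (blast, metis Int_commute)
  have T: "(int CARD('r) - 1 + (int CARD('e) - 1)) simplex T"
      "{v. v extreme_point_of T} \<subseteq> range product_vertex"
    using assms(1,2) unfolding product_triangulation_def by blast+
  have T': "(int CARD('r) - 1 + (int CARD('e) - 1)) simplex T'"
    using assms(1,3) unfolding product_triangulation_def by blast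
  \<comment> \<open>The weight concentrated on the graph of \<open>r\<close>. For injective
    \<open>r\<close> its margins depend only on \<open>range r\<close>, so those of \<open>p\<close>
    and \<open>q\<close> agree.\<close>
  define ind where "ind r e = (of_bool (snd e = r (fst e)) :: real)" for r :: "'r \<Rightarrow> 'e" and e
  have rows: "(\<Sum>j\<in>UNIV. ind r (i, j)) = 1" for r i
    by (simp add: ind_def)
  have cols: "(\<Sum>i\<in>UNIV. ind r (i, j)) = of_bool (j \<in> range r)" if "inj r" for r j
  proof -
    have "(\<Sum>i\<in>UNIV. ind r (i, j)) = real (\<Sum>i\<in>UNIV. of_bool (r i = j))"
      by (simp add: ind_def eq_commute)
    then show ?thesis
      by (simp only: sum_of_bool_inj[OF that] of_nat_of_bool)
  qed
  have "pt r = (1 / real CARD('r)) *\<^sub>R (\<Sum>e\<in>UNIV. ind r e *\<^sub>R product_vertex e)" for r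
  proof -
    have "(\<Sum>e\<in>UNIV. ind r e *\<^sub>R product_vertex e) = (\<Sum>i\<in>UNIV. product_vertex (i, r i))"
      unfolding sum_edges_by_row
      by (simp add: ind_def of_bool_def if_distrib[of "\<lambda>x. x *\<^sub>R _"] cong: if_cong)
    then show ?thesis
      by (simp add: pt_def scaleR_sum_right)
  qed
  then have eq: "pt p = pt q"
    using rows cols p(1) q(1,3) by (simp add: sum_product_vertex)
  have in_hull: "pt r \<in> S" if "convex S" "\<And>i. product_vertex (i, r i) \<in> S" for r S
    unfolding pt_def using that by (intro convex_sum) auto
  have ext: "product_vertex (i, p i) extreme_point_of T" "product_vertex (i, q i) extreme_point_of T'" for i
    using p(2) q(2) by (auto simp: simplex_edges_def)
  have "pt p \<in> T" "pt q \<in> T'"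
    using T(1) T' ext by (auto intro!: in_hull convex_simplex simp: extreme_point_of_def)
  then have "pt q \<in> T \<inter> T'"
    using eq by auto
  have "product_vertex (i, q i) \<in> T \<inter> T'" for i
    using barycentre_in_face[OF tri(2) convex_simplex[OF T'] finite, of UNIV "\<lambda>i. product_vertex (i, q i)" i]
      ext(2) \<open>pt q \<in> T \<inter> T'\<close> by (simp add: pt_def extreme_point_of_def)
  \<comment> \<open>An extreme point of \<open>T'\<close> in the common face is extreme in that
    face, hence in \<open>T\<close>. So both matchings live on the forest of \<open>T\<close>, where
    equal margins force equality.\<close>
  then have "product_vertex (i, q i) extreme_point_of T" for i
    using ext(2) extreme_point_of_face[OF tri(1)] extreme_point_of_face[OF tri(2)] by blast
  then have "(i, q i) \<in> simplex_edges T" for i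
    by (simp add: simplex_edges_def)
  then have "ind p = ind q"
    using p q(1,3) rows cols
    by (intro margin_independent_eq[OF simplex_edges_margin_independent[OF T]])
      (auto simp: ind_def)
  then have "ind q (i, p i) = 1" for i
    by (metis (mono_tags) ind_def fst_conv snd_conv of_bool_eq_1_iff)
  then show ?thesis
    by (auto simp: ind_def fun_eq_iff)
qed

section \<open>Matchings of the field inside one simplex\<close>

definition partner :: "('r \<times> 'e) set \<Rightarrow> 'r \<Rightarrow> 'e"
  where "partner M i = (THE j. (i, j) \<in> M)"

lemma perfect_matching_partner:
  assumes "perfect_matching \<sigma> M"
  shows "M = range (\<lambda>i. (i, partner M i))" "inj (partner M)" "range (partner M) = \<sigma>"
proof -
  have mem: "(i, j) \<in> M \<longleftrightarrow> j = partner M i" for i j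
    using assms unfolding perfect_matching_def partner_def by (metis (mono_tags, lifting) theI')
  then show "M = range (\<lambda>i. (i, partner M i))"
    by auto
  show "range (partner M) = \<sigma>"
    using assms mem unfolding perfect_matching_def by (auto simp: image_iff) metis
  then show "inj (partner M)"
    using assms mem unfolding perfect_matching_def inj_def by (metis rangeI)
qed

text \<open>The definition places \<open>M (range p)\<close> in some simplex, possibly other than
  the one containing the graph of \<open>p\<close>; uniqueness across simplices identifies the two
  matchings.\<close>

lemma polyhedral_matching_fieldE:
  fixes M :: "'e::finite set \<Rightarrow> ('r::finite \<times> 'e) set"
  assumes "polyhedral_matching_field M"
  obtains \<T> :: "((real ^ 'r) \<times> (real ^ 'e)) set set" where "product_triangulation \<T>"
    "\<And>T p. T \<in> \<T> \<Longrightarrow> inj p \<Longrightarrow> (\<And>i. (i, p i) \<in> simplex_edges T) \<Longrightarrow> partner (M (range p)) = p"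
proof -
  obtain \<T> :: "((real ^ 'r) \<times> (real ^ 'e)) set set" where \<T>: "product_triangulation \<T>"
    "\<And>\<sigma>. card \<sigma> = CARD('r) \<Longrightarrow> perfect_matching \<sigma> (M \<sigma>) \<and> (\<exists>T\<in>\<T>. M \<sigma> \<subseteq> simplex_edges T)"
    using assms unfolding polyhedral_matching_field_def by blast
  have "partner (M (range p)) = p" if *: "T \<in> \<T>" "inj p" "\<And>i. (i, p i) \<in> simplex_edges T" for T p
  proof -
    have "card (range p) = CARD('r)"
      using *(2) by (simp add: card_image)
    then obtain T' where T': "T' \<in> \<T>" "M (range p) \<subseteq> simplex_edges T'"
      and pm: "perfect_matching (range p) (M (range p))"
      using \<T>(2) by blast
    have "(i, partner (M (range p)) i) \<in> simplex_edges T'" for i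
      using T'(2) perfect_matching_partner(1)[OF pm] by blast
    then show ?thesis
      using matching_in_simplices_unique[OF \<T>(1) *(1) T'(1) *(2,3)] perfect_matching_partner[OF pm]
      by metis
  qed
  then show thesis
    using \<T>(1) that by blast
qed

text \<open>The order of quantifiers is the point: \<open>N\<close> is fixed before the four
  elements are labelled, so different labellings make statements about the same multigraph.\<close>

lemma polyhedral_exchange:
  fixes M :: "'e::finite set \<Rightarrow> ('r::finite \<times> 'e) set"
  assumes "polyhedral_matching_field M" "card X + 2 = CARD('r)" "card F = 4" "F \<inter> X = {}"
  obtains N :: "'r \<times> 'e \<Rightarrow> nat" where
    "\<And>a b c d. F = {a, b, c, d} \<Longrightarrow>
      (\<forall>i j. N (i, j) = of_bool (partner (M ({a, c} \<union> X)) i = j) + of_bool (partner (M ({b, d} \<union> X)) i = j)) \<or>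
      (\<forall>i j. N (i, j) = of_bool (partner (M ({a, d} \<union> X)) i = j) + of_bool (partner (M ({b, c} \<union> X)) i = j))"
proof -
  obtain \<T> :: "((real ^ 'r) \<times> (real ^ 'e)) set set" where \<T>: "product_triangulation \<T>"
    "\<And>T p. T \<in> \<T> \<Longrightarrow> inj p \<Longrightarrow> (\<And>i. (i, p i) \<in> simplex_edges T) \<Longrightarrow> partner (M (range p)) = p"
    using polyhedral_matching_fieldE[OF assms(1)] by metis
  \<comment> \<open>Degree 2 on the elements of \<open>X\<close>, two fewer than the rows, and
    degree 1 on four more add up to twice the number of rows, as do the row degrees. Division by
    \<open>D\<close> therefore puts the point into both simplices.\<close>
  define D where "D = real (2 * CARD('r))"
  have D: "D > 0"
    by (simp add: D_def)
  define deg where "deg j = (if j \<in> X then 2 else if j \<in> F then 1 else 0 :: nat)" for j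
  have deg_sum: "(\<Sum>j\<in>UNIV. deg j) = 2 * CARD('r)"
  proof -
    have "deg j = 2 * of_bool (j \<in> X) + of_bool (j \<in> F)" for j
      using assms(4) by (auto simp: deg_def)
    then have "(\<Sum>j\<in>UNIV. deg j) = 2 * card X + card F"
      by (simp add: sum.distrib sum_distrib_left[symmetric] of_bool_def sum.If_cases)
    then show ?thesis
      using assms(2,3) by simp
  qed
  define x :: "(real ^ 'r) \<times> (real ^ 'e)" where "x = ((\<chi> i. 2 / D), (\<chi> j. real (deg j) / D))"
  have "(\<Sum>j\<in>UNIV. real (deg j)) = D"
    using deg_sum by (simp add: D_def of_nat_sum[symmetric] del: of_nat_sum)
  then have "x \<in> vertex_simplex \<times> vertex_simplex"
    using D by (auto simp: x_def D_def sum_divide_distrib[symmetric] intro!: vertex_simplexI)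
  then obtain T where "T \<in> \<T>" "x \<in> T"
    using \<T>(1) unfolding product_triangulation_def by blast
  have T: "(int CARD('r) - 1 + (int CARD('e) - 1)) simplex T"
      "{v. v extreme_point_of T} \<subseteq> range product_vertex"
    using \<T>(1) \<open>T \<in> \<T>\<close> unfolding product_triangulation_def by blast+
  obtain f where f: "\<And>e. 0 \<le> f e" "\<And>e. e \<notin> simplex_edges T \<Longrightarrow> f e = 0"
    "\<And>i. (\<Sum>j\<in>UNIV. f (i, j)) = fst x $ i" "\<And>j. (\<Sum>i\<in>UNIV. f (i, j)) = snd x $ j"
    using simplex_point_weights[OF T \<open>x \<in> T\<close>] by metis
  have margins: "(\<Sum>j\<in>UNIV. D * f (i, j)) = 2" "(\<Sum>i\<in>UNIV. D * f (i, j)) = real (deg j)" for i j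
    using D f(3)[of i] f(4)[of j] by (simp_all add: sum_distrib_left[symmetric] x_def)
  have "D * f e \<in> \<int>" for e
    by (rule margin_independent_integral[OF simplex_edges_margin_independent[OF T], where f = "\<lambda>e. D * f e"])
      (auto simp: f(2) margins)
  then have "D * f e \<in> \<nat>" for e
    using f(1) D by (simp add: Nats_altdef2)
  then have "\<exists>n. D * f e = real n" for e
    using Nats_cases by metis
  then obtain N where N: "\<And>e. D * f e = real (N e)"
    by metis
  have rows: "(\<Sum>j\<in>UNIV. N (i, j)) = 2" and cols: "(\<Sum>i\<in>UNIV. N (i, j)) = deg j" for i j
    using margins(1)[of i] margins(2)[of j] unfolding N of_nat_sum[symmetric] by linarith+
  have support: "e \<in> simplex_edges T" if "N e \<noteq> 0" for e
    using N[of e] f(2)[of e] that by fastforce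
  show thesis
  proof (rule that)
    fix a b c d assume F: "F = {a, b, c, d}"
    then have distinct: "distinct [a, b, c, d]"
      using assms(3) by (intro card_distinct) simp
    obtain p q :: "'r \<Rightarrow> 'e" where pq: "\<And>i j. N (i, j) = of_bool (p i = j) + of_bool (q i = j)"
      "inj p" "inj q"
      "range p = {a, c} \<union> X \<and> range q = {b, d} \<union> X \<or> range p = {a, d} \<union> X \<and> range q = {b, c} \<union> X"
    proof (rule split_merged[of X a b c d N])
      show "{a, b, c, d} \<inter> X = {}"
        using assms(4) F by simp
      show "(\<Sum>i\<in>UNIV. N (i, j)) = (if j \<in> X then 2 else if j \<in> {a, b, c, d} then 1 else 0)" for j
        using cols[of j] unfolding deg_def F .
    qed (use assms(2) distinct rows in auto)
    \<comment> \<open>\<open>N\<close> is positive on all edges of \<open>p\<close> and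
      \<open>q\<close>, so both matchings lie in the simplex \<open>T\<close>.\<close>
    have "partner (M (range p)) = p" "partner (M (range q)) = q"
      using pq(1) support by (auto intro!: \<T>(2)[OF \<open>T \<in> \<T>\<close>] pq(2,3))
    then show "(\<forall>i j. N (i, j) =
          of_bool (partner (M ({a, c} \<union> X)) i = j) + of_bool (partner (M ({b, d} \<union> X)) i = j)) \<or>
        (\<forall>i j. N (i, j) =
          of_bool (partner (M ({a, d} \<union> X)) i = j) + of_bool (partner (M ({b, c} \<union> X)) i = j))"
      using pq(1,4) by metis
  qed
qed

section \<open>The three-term relation\<close>

context hyperfield
begin

lemma mult_minus_right:
  assumes "x \<in> carrier H" "y \<in> carrier H"
  shows "x \<otimes> (minus_one \<otimes> y) = minus_one \<otimes> (x \<otimes> y)"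
  using assms minus_one_closed by (simp add: mult.m_lcomm)

text \<open>Each equation in the last hypothesis differs from an equality of two terms by one
  transposed factor, so it says that these terms are opposite. This is the form in which exchanging
  partners yields it.\<close>

lemma three_term_relation:
  fixes c :: "'e \<Rightarrow> 'e \<Rightarrow> 'a"
  assumes infl: "inflation_property H"
    and closed: "\<And>x y. c x y \<in> carrier H"
    and swap: "\<And>x y. c y x = minus_one \<otimes> c x y"
    and "t1 = c x1 x2 \<otimes> c y1 y2" "t2 = c x1 y1 \<otimes> c y2 x2" "t3 = c x1 y2 \<otimes> c x2 y1"
    and cases: "c x1 x2 \<otimes> c y2 y1 = c x1 y1 \<otimes> c y2 x2 \<and> (t3 = hzero H \<or> t1 \<noteq> hzero H) \<or>
      c x1 x2 \<otimes> c y1 y2 = c x1 y2 \<otimes> c y1 x2 \<and> (t2 = hzero H \<or> t3 \<noteq> hzero H) \<or>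
      c x1 y1 \<otimes> c x2 y2 = c x1 y2 \<otimes> c x2 y1 \<and> (t1 = hzero H \<or> t2 \<noteq> hzero H)"
  shows "hzero H \<in> hadd3 H t1 t2 t3"
proof (rule hzero_in_hadd3_pairs[OF infl])
  show t: "t1 \<in> carrier H" "t2 \<in> carrier H" "t3 \<in> carrier H"
    using closed assms(4-6) by simp_all
  have flip: "s = minus_one \<otimes> t" if "t = minus_one \<otimes> s" "s \<in> carrier H" for s t
    using that minus_minus by simp
  have "t1 = minus_one \<otimes> t2" if "c x1 x2 \<otimes> c y2 y1 = c x1 y1 \<otimes> c y2 x2"
    unfolding assms(4,5) that[symmetric] swap[of y1 y2] by (rule mult_minus_right[OF closed closed])
  moreover have "t3 = minus_one \<otimes> t1" if "c x1 x2 \<otimes> c y1 y2 = c x1 y2 \<otimes> c y1 x2"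
    unfolding assms(4,6) that swap[of x2 y1] by (rule mult_minus_right[OF closed closed])
  moreover have "t2 = minus_one \<otimes> t3" if "c x1 y1 \<otimes> c x2 y2 = c x1 y2 \<otimes> c x2 y1"
    unfolding assms(5,6) that[symmetric] swap[of y2 x2] by (rule mult_minus_right[OF closed closed])
  ultimately show "t2 = minus_one \<otimes> t1 \<and> (t3 = hzero H \<or> t1 \<noteq> hzero H) \<or>
      t3 = minus_one \<otimes> t2 \<and> (t1 = hzero H \<or> t2 \<noteq> hzero H) \<or>
      t1 = minus_one \<otimes> t3 \<and> (t2 = hzero H \<or> t3 \<noteq> hzero H)"
    using cases flip t by metis
qed

section \<open>Values of the alternating function\<close>

lemma alternating_extension_closed:
  assumes "distinct xs \<Longrightarrow> f (set xs) \<in> carrier H"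
  shows "alternating_extension H f xs \<in> carrier H"
  using assms hsign_closed hzero_closed mult_closed by (simp add: alternating_extension_def)

lemma alternating_extension_neq_hzero:
  assumes "distinct xs" "f (set xs) \<in> carrier H" "f (set xs) \<noteq> hzero H"
  shows "alternating_extension H f xs \<noteq> hzero H"
  using assms hsign_closed hsign_neq_hzero mult_nonzero by (simp add: alternating_extension_def)

lemma alternating_extension_permute_list:
  assumes "p permutes {..<length xs}" "distinct xs \<Longrightarrow> f (set xs) \<in> carrier H"
  shows "alternating_extension H f (permute_list p xs) = hsign H p \<otimes> alternating_extension H f xs"
proof (cases "distinct xs")
  case True
  have "hsign H (rank_perm (permute_list p xs)) = hsign H p \<otimes> hsign H (rank_perm xs)"
    using sign_rank_perm_permute_list[OF True assms(1)] by (intro hsign_mult[symmetric]) simp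
  then show ?thesis
    using True assms hsign_closed mult.m_assoc by (simp add: alternating_extension_def)
next
  case False
  then show ?thesis
    using assms(1) mult_hzero hsign_closed by (simp add: alternating_extension_def)
qed

lemma alternating_extension_swap:
  assumes "distinct (x # y # X) \<Longrightarrow> f (set (x # y # X)) \<in> carrier H"
  shows "alternating_extension H f (y # x # X) = minus_one \<otimes> alternating_extension H f (x # y # X)"
proof -
  let ?p = "Transposition.transpose 0 (Suc 0) :: nat \<Rightarrow> nat"
  have p: "?p permutes {..<length (x # y # X)}"
    by (intro permutes_swap_id) auto
  have "permute_list ?p (x # y # X) = y # x # X"
  proof (rule nth_equalityI)
    fix k assume "k < length (permute_list ?p (x # y # X))"
    then have "permute_list ?p (x # y # X) ! k = (x # y # X) ! ?p k"
      by (intro permute_list_nth[OF p]) simp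
    also have "\<dots> = (y # x # X) ! k"
      by (auto simp: Transposition.transpose_def nth_Cons split: nat.split)
    finally show "permute_list ?p (x # y # X) ! k = (y # x # X) ! k" .
  qed simp
  moreover have "hsign H ?p = minus_one"
    by (simp add: hsign_def sign_swap_id)
  ultimately show ?thesis
    using alternating_extension_permute_list[where xs = "x # y # X" and f = f, OF p] assms by simp
qed

text \<open>The sign of the tuple and the sign of the matching both refer to the order on
  \<open>'e\<close>; their product does not, since \<open>p\<close> records only slots in the tuple
  \<open>xs\<close>.\<close>

lemma matching_value:
  fixes M :: "('r::{finite,linorder} \<times> 'e::linorder) set" and A :: "'r \<times> 'e \<Rightarrow> 'a"
  assumes "distinct xs" "length xs = CARD('r)" "perfect_matching (set xs) M"
    and pos: "\<And>i. i < length xs \<Longrightarrow> pos (xs ! i) = i"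
    and A: "\<And>e. A e \<in> carrier H"
    and p_def: "\<And>k. p k = (if k < CARD('r) then pos (partner M (sorted_list_of_set UNIV ! k)) else k)"
  shows "p permutes {..<CARD('r)}"
    and "hsign H (rank_perm xs) \<otimes> (hsign H (matching_perm M) \<otimes> (\<Otimes>e\<in>M. A e)) =
      hsign H p \<otimes> (\<Otimes>i\<in>UNIV. A (i, partner M i))"
proof -
  define ys where "ys = map (partner M) (sorted_list_of_set UNIV)"
  note pm = perfect_matching_partner[OF assms(3)]
  have ys: "distinct ys" "set ys = set xs" "matching_perm M = rank_perm ys"
    using pm by (simp_all add: ys_def distinct_map inj_on_subset matching_perm_def partner_def[abs_def])
  have p: "p k = (if k < length xs then pos (ys ! k) else k)" for k
    by (simp add: p_def ys_def assms(2))
  note * = sign_rank_perm_mult_rank_perm[OF assms(1) ys(1,2) pos p]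
  show "p permutes {..<CARD('r)}"
    using *(1) assms(2) by simp
  have "hsign H (rank_perm xs) \<otimes> hsign H (matching_perm M) = hsign H p"
    using *(2) ys(3) by (intro hsign_mult) simp
  moreover have "(\<Otimes>e\<in>M. A e) = (\<Otimes>i\<in>UNIV. A (i, partner M i))"
    by (subst pm(1), rule mult.finprod_reindex) (auto simp: A inj_on_def)
  ultimately show "hsign H (rank_perm xs) \<otimes> (hsign H (matching_perm M) \<otimes> (\<Otimes>e\<in>M. A e)) =
      hsign H p \<otimes> (\<Otimes>i\<in>UNIV. A (i, partner M i))"
    using A hsign_closed by (simp add: mult.m_assoc[symmetric])
qed

end

text \<open>Both sides are multiplicity functions of two-element multisets.\<close>

lemma of_bool_pair_eqD:
  assumes "\<And>j. of_bool (x = j) + of_bool (y = j) = (of_bool (u = j) + of_bool (v = j) :: nat)"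
  shows "u = x \<and> v = y \<or> u = y \<and> v = x"
proof (cases "u = x")
  case True
  then have "of_bool (y = y) = (of_bool (v = y) :: nat)"
    using assms[of y] by simp
  then show ?thesis
    using True by (cases "v = y") simp_all
next
  case False
  then have "v = x"
    using assms[of x] by (cases "v = x") simp_all
  then have "of_bool (y = y) = (of_bool (u = y) :: nat)"
    using assms[of y] by simp
  then show ?thesis
    using \<open>v = x\<close> by (cases "u = y") simp_all
qed

lemma (in hyperfield) matching_exchange:
  fixes M :: "'e::{finite,linorder} set \<Rightarrow> ('r::{finite,linorder} \<times> 'e) set" and A :: "'r \<times> 'e \<Rightarrow> 'a"
  defines "chi \<equiv> alternating_extension H
      (\<lambda>\<sigma>. hsign H (matching_perm (M \<sigma>)) \<otimes> (\<Otimes>e\<in>M \<sigma>. A e))"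
  assumes pm: "\<And>\<sigma>. card \<sigma> = CARD('r) \<Longrightarrow> perfect_matching \<sigma> (M \<sigma>)"
    and A: "\<And>e. A e \<in> carrier H"
    and X: "length X + 2 = CARD('r)" and distinct: "distinct (a # b # c # d # X)"
    and N: "\<forall>i j. N (i, j) = of_bool (partner (M ({a, c} \<union> set X)) i = j) +
        of_bool (partner (M ({b, d} \<union> set X)) i = j)"
      "\<forall>i j. N (i, j) = (of_bool (partner (M ({a, d} \<union> set X)) i = j) +
        of_bool (partner (M ({b, c} \<union> set X)) i = j) :: nat)"
  shows "chi (a # c # X) \<otimes> chi (b # d # X) = chi (a # d # X) \<otimes> chi (b # c # X)"
proof -
  \<comment> \<open>Shared slots for \<open>a\<close>, \<open>b\<close> and for \<open>c\<close>,
    \<open>d\<close>: this one function reads off positions in all four tuples.\<close>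
  define pos where "pos e = (if e = a \<or> e = b then 0 else if e = c \<or> e = d then 1
      else Suc (Suc (THE i. i < length X \<and> X ! i = e)))" for e
  define m where "m u v = partner (M (set (u # v # X)))" for u v
  define p where "p u v k = (if k < CARD('r) then pos (m u v (sorted_list_of_set UNIV ! k)) else k)"
    for u v k
  define P where "P u v = (\<Otimes>i\<in>UNIV. A (i, m u v i))" for u v
  have P: "P u v \<in> carrier H" for u v
    unfolding P_def using A by (intro mult.finprod_closed) auto
  have pos: "pos ((u # v # X) ! i) = i" if "u \<in> {a, b}" "v \<in> {c, d}" "i < length (u # v # X)" for u v i
  proof -
    have "pos (X ! k) = Suc (Suc k)" if "k < length X" for k
    proof -
      have "(THE i. i < length X \<and> X ! i = X ! k) = k"
        using that distinct by (intro the_equality) (auto simp: nth_eq_iff_index_eq)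
      moreover have "X ! k \<in> set X"
        using that by simp
      ultimately show ?thesis
        using distinct by (auto simp: pos_def)
    qed
    then show ?thesis
      using that distinct by (cases i; cases "i - 1") (auto simp: pos_def)
  qed
  have chi: "p u v permutes {..<CARD('r)} \<and> chi (u # v # X) = hsign H (p u v) \<otimes> P u v"
    if "u \<in> {a, b}" "v \<in> {c, d}" for u v
  proof -
    have d: "distinct (u # v # X)"
      using that distinct by auto
    then have "card (set (u # v # X)) = CARD('r)"
      using X distinct_card by fastforce
    then have "perfect_matching (set (u # v # X)) (M (set (u # v # X)))"
      by (rule pm)
    note * = matching_value[OF d _ this pos[OF that] A p_def[of u v, unfolded m_def]]
    show ?thesis
      using * X d unfolding chi_def alternating_extension_def P_def m_def by simp
  qed
  \<comment> \<open>Row \<open>i\<close> of \<open>N\<close> has the same two edges in both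
    decompositions, possibly exchanged. This settles the signs and, factor by factor, the products
    of entries.\<close>
  have ex: "m a d i = m a c i \<and> m b c i = m b d i \<or> m a d i = m b d i \<and> m b c i = m a c i" for i
    using N by (intro of_bool_pair_eqD) (simp add: m_def)
  have "p a d k = p a c k \<and> p b c k = p b d k \<or> p a d k = p b d k \<and> p b c k = p a c k" for k
    using ex[of "sorted_list_of_set UNIV ! k"] by (cases "k < CARD('r)") (auto simp: p_def)
  then have "sign (p a c) * sign (p b d) = sign (p a d) * sign (p b c)"
    using chi by (intro sign_mult_eq_of_exchange[where n = "CARD('r)"]) auto
  moreover have "sign (p u v \<circ> p u' v') = sign (p u v) * sign (p u' v')"
    if "u \<in> {a, b}" "v \<in> {c, d}" "u' \<in> {a, b}" "v' \<in> {c, d}" for u v u' v'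
    using chi that by (intro sign_compose permutation_of_permutes) auto
  ultimately have "hsign H (p a c) \<otimes> hsign H (p b d) = hsign H (p a d) \<otimes> hsign H (p b c)"
    by (metis hsign_mult insertCI)
  moreover have "P a c \<otimes> P b d = P a d \<otimes> P b c"
  proof -
    have "P a c \<otimes> P b d = (\<Otimes>i\<in>UNIV. A (i, m a c i) \<otimes> A (i, m b d i))"
      unfolding P_def using A by (intro mult.finprod_multf[symmetric]) auto
    also have "\<dots> = (\<Otimes>i\<in>UNIV. A (i, m a d i) \<otimes> A (i, m b c i))"
    proof (rule mult.finprod_cong')
      fix i
      show "A (i, m a c i) \<otimes> A (i, m b d i) = A (i, m a d i) \<otimes> A (i, m b c i)"
        using ex[of i] A mult.m_comm by metis
    qed (use A mult_closed in auto)
    also have "\<dots> = P a d \<otimes> P b c"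
      unfolding P_def using A by (intro mult.finprod_multf) auto
    finally show ?thesis .
  qed
  moreover have "(hsign H f \<otimes> u) \<otimes> (hsign H g \<otimes> v) = (hsign H f \<otimes> hsign H g) \<otimes> (u \<otimes> v)"
    if "u \<in> carrier H" "v \<in> carrier H" for f g u v
    using that hsign_closed by (simp add: mult.m_ac)
  ultimately show ?thesis
    using chi P by simp
qed

theorem theorem5p8:
  fixes H :: "('a, 'm) hyperstructure_scheme"
    and M :: "'e::{finite,linorder} set \<Rightarrow> ('r::{finite,linorder} \<times> 'e) set"
    and A :: "'r \<times> 'e \<Rightarrow> 'a"
  assumes "CARD('r) \<le> CARD('e)"
    and "polyhedral_matching_field M"
    and "hyperfield H"
    and "inflation_property H"
    and "\<And>e. A e \<in> carrier H" and "\<And>e. A e \<noteq> hzero H"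
  shows "weak_matroid H CARD('r)
    (alternating_extension H
      (\<lambda>\<sigma>. hsign H (matching_perm (M \<sigma>)) \<otimes>\<^bsub>H\<^esub> (\<Otimes>\<^bsub>H\<^esub>e\<in>M \<sigma>. A e)))"
proof -
  interpret hyperfield H
    by fact
  define f where "f \<sigma> = hsign H (matching_perm (M \<sigma>)) \<otimes>\<^bsub>H\<^esub> (\<Otimes>\<^bsub>H\<^esub>e\<in>M \<sigma>. A e)" for \<sigma>
  define chi where "chi = alternating_extension H f"
  have pm: "perfect_matching \<sigma> (M \<sigma>)" if "card \<sigma> = CARD('r)" for \<sigma>
    using assms(2) that unfolding polyhedral_matching_field_def by blast
  have prod: "(\<Otimes>\<^bsub>H\<^esub>e\<in>S. A e) \<in> carrier H \<and> (\<Otimes>\<^bsub>H\<^esub>e\<in>S. A e) \<noteq> hzero H" if "finite S" for S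
    using that
  proof (induction S)
    case empty
    then show ?case
      using hzero_neq_one by auto
  next
    case (insert e S)
    then show ?case
      using assms(5,6) mult_nonzero by (auto simp: mult.finprod_insert)
  qed
  have f: "f \<sigma> \<in> carrier H" "f \<sigma> \<noteq> hzero H" for \<sigma>
    using prod[of "M \<sigma>"] hsign_closed hsign_neq_hzero mult_closed mult_nonzero
    by (simp_all add: f_def)
  have closed: "chi xs \<in> carrier H" for xs
    unfolding chi_def using f by (intro alternating_extension_closed)
  have chi_zero: "chi xs = hzero H \<longleftrightarrow> \<not> distinct xs" for xs
    using alternating_extension_neq_hzero[of xs f] f by (auto simp: chi_def alternating_extension_def)
  have swap: "chi (y # x # X) = minus_one \<otimes>\<^bsub>H\<^esub> chi (x # y # X)" for x y X
    unfolding chi_def using f by (intro alternating_extension_swap)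
  \<comment> \<open>As no entry of \<open>A\<close> vanishes, the underlying matroid is
    uniform.\<close>
  have bases: "{\<sigma>. card \<sigma> = CARD('r) \<and> chi (sorted_list_of_set \<sigma>) \<noteq> hzero H} = {\<sigma>. card \<sigma> = CARD('r)}"
    by (simp add: chi_zero)
  obtain \<sigma>0 :: "'e set" where \<sigma>0: "card \<sigma>0 = CARD('r)"
    using obtain_subset_with_card_n[OF assms(1)] by metis
  have "matroid_bases {\<sigma> :: 'e set. card \<sigma> = CARD('r)}"
    unfolding matroid_bases_def
  proof (intro conjI ballI)
    show "{\<sigma> :: 'e set. card \<sigma> = CARD('r)} \<noteq> {}"
      using \<sigma>0 by blast
    fix B B' :: "'e set" and x
    assume B: "B \<in> {\<sigma>. card \<sigma> = CARD('r)}" "B' \<in> {\<sigma>. card \<sigma> = CARD('r)}" and x: "x \<in> B - B'"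
    have "\<not> B' \<subseteq> B"
      using B x card_subset_eq[of B B'] by auto
    then obtain y where y: "y \<in> B' - B"
      by blast
    then have "card (insert y (B - {x})) = card B"
      using x card.remove[of B x] by (simp add: card_insert_if)
    then show "\<exists>y\<in>B' - B. insert y (B - {x}) \<in> {\<sigma>. card \<sigma> = CARD('r)}"
      using B(1) y by auto
  qed
  moreover have "\<exists>xs. length xs = CARD('r) \<and> chi xs \<noteq> hzero H"
    using \<sigma>0 by (intro exI[of _ "sorted_list_of_set \<sigma>0"]) (simp add: chi_zero)
  moreover have "alternating H CARD('r) chi"
    unfolding alternating_def using chi_zero f
    by (auto simp: chi_def intro: alternating_extension_permute_list)
  moreover have "hzero H \<in> hadd3 H
      (chi (x1 # x2 # X) \<otimes>\<^bsub>H\<^esub> chi (y1 # y2 # X))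
      (chi (x1 # y1 # X) \<otimes>\<^bsub>H\<^esub> chi (y2 # x2 # X))
      (chi (x1 # y2 # X) \<otimes>\<^bsub>H\<^esub> chi (x2 # y1 # X))" (is "hzero H \<in> hadd3 H ?t1 ?t2 ?t3")
    if X: "length X + 2 = CARD('r)" for x1 x2 y1 y2 X
  proof (rule three_term_relation[where c = "\<lambda>x y. chi (x # y # X)"])
    have prod_zero: "chi xs \<otimes>\<^bsub>H\<^esub> chi ys = hzero H \<longleftrightarrow> \<not> distinct xs \<or> \<not> distinct ys" for xs ys
      using closed chi_zero mult_nonzero hzero_mult mult_hzero by metis
    let ?e12 = "chi (x1 # x2 # X) \<otimes>\<^bsub>H\<^esub> chi (y2 # y1 # X) = chi (x1 # y1 # X) \<otimes>\<^bsub>H\<^esub> chi (y2 # x2 # X)"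
    let ?e13 = "chi (x1 # x2 # X) \<otimes>\<^bsub>H\<^esub> chi (y1 # y2 # X) = chi (x1 # y2 # X) \<otimes>\<^bsub>H\<^esub> chi (y1 # x2 # X)"
    let ?e23 = "chi (x1 # y1 # X) \<otimes>\<^bsub>H\<^esub> chi (x2 # y2 # X) = chi (x1 # y2 # X) \<otimes>\<^bsub>H\<^esub> chi (x2 # y1 # X)"
    show "?e12 \<and> (?t3 = hzero H \<or> ?t1 \<noteq> hzero H) \<or> ?e13 \<and> (?t2 = hzero H \<or> ?t3 \<noteq> hzero H) \<or>
      ?e23 \<and> (?t1 = hzero H \<or> ?t2 \<noteq> hzero H)"
    proof (cases "distinct (x1 # x2 # y1 # y2 # X)")
      \<comment> \<open>A repetition involving \<open>X\<close> makes all three terms vanish. Any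
        other coincidence makes one term vanish, and the remaining two are opposite by commutativity
        after one transposition.\<close>
      case False
      then consider "\<not> distinct X \<or> x1 \<in> set X \<or> x2 \<in> set X \<or> y1 \<in> set X \<or> y2 \<in> set X"
        | "x1 = x2 \<or> y1 = y2" | "x1 = y1 \<or> x2 = y2" | "x1 = y2 \<or> x2 = y1"
        by auto
      then show ?thesis
      proof cases
        case 1
        then have "?t1 = hzero H" "?t2 = hzero H" "?t3 = hzero H"
          "chi (x1 # x2 # X) \<otimes>\<^bsub>H\<^esub> chi (y2 # y1 # X) = hzero H"
          unfolding prod_zero by auto
        then show ?thesis
          by simp
      next
        case 2
        then have "?t1 = hzero H"
          unfolding prod_zero by auto
        moreover have ?e23
          using 2 mult.m_comm closed by auto
        ultimately show ?thesis
          by simp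
      next
        case 3
        then have "?t2 = hzero H"
          unfolding prod_zero by auto
        moreover have ?e13
          using 3 mult.m_comm closed by auto
        ultimately show ?thesis
          by simp
      next
        case 4
        then have "?t3 = hzero H"
          unfolding prod_zero by auto
        moreover have ?e12
          using 4 mult.m_comm closed by auto
        ultimately show ?thesis
          by simp
      qed
    next
      case True
      then have nz: "?t1 \<noteq> hzero H" "?t2 \<noteq> hzero H" "?t3 \<noteq> hzero H"
        unfolding prod_zero by auto
      let ?F = "{x1, x2, y1, y2}"
      have "card (set X) + 2 = CARD('r)" "card ?F = 4" "?F \<inter> set X = {}"
        using True X distinct_card[of X] by auto
      then obtain N :: "'r \<times> 'e \<Rightarrow> nat" where N: "\<And>a b c d. ?F = {a, b, c, d} \<Longrightarrow>
          (\<forall>i j. N (i, j) = of_bool (partner (M ({a, c} \<union> set X)) i = j) + of_bool (partner (M ({b, d} \<union> set X)) i = j)) \<or>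
          (\<forall>i j. N (i, j) = of_bool (partner (M ({a, d} \<union> set X)) i = j) + of_bool (partner (M ({b, c} \<union> set X)) i = j))"
        using polyhedral_exchange[OF assms(2), of "set X" ?F] by blast
      \<comment> \<open>\<open>D a c b d\<close> says that \<open>N\<close> is the union of the two
        matchings for the splitting ac|bd.\<close>
      define D where "D a c b d \<longleftrightarrow> (\<forall>i j. N (i, j) =
          of_bool (partner (M ({a, c} \<union> set X)) i = j) + of_bool (partner (M ({b, d} \<union> set X)) i = j))"
        for a b c d
      have D_swap: "D a c b d \<longleftrightarrow> D a c d b" for a b c d
        unfolding D_def by (simp add: insert_commute)
      have exch: "chi (a # c # X) \<otimes>\<^bsub>H\<^esub> chi (b # d # X) = chi (a # d # X) \<otimes>\<^bsub>H\<^esub> chi (b # c # X)"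
        if "D a c b d" "D a d b c" "distinct (a # b # c # d # X)" for a b c d
        using matching_exchange[OF pm assms(5) X that(3), of N] that(1,2)
        unfolding D_def chi_def f_def by simp
      \<comment> \<open>One clause per merging, each omitting a different splitting; together they
        force two of the three splittings.\<close>
      have "D x1 y1 x2 y2 \<or> D x1 y2 x2 y1" "D x1 x2 y1 y2 \<or> D x1 y2 y1 x2" "D x1 x2 y2 y1 \<or> D x1 y1 y2 x2"
        by (rule N[folded D_def]; simp add: insert_commute)+
      then have "D x1 x2 y2 y1 \<and> D x1 y1 y2 x2 \<or> D x1 x2 y1 y2 \<and> D x1 y2 y1 x2 \<or> D x1 y1 x2 y2 \<and> D x1 y2 x2 y1"
        using D_swap[of x1 x2 y1 y2] D_swap[of x1 y1 x2 y2] D_swap[of x1 y2 x2 y1] by argo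
      moreover have "distinct (x1 # y2 # x2 # y1 # X)" "distinct (x1 # y1 # x2 # y2 # X)"
          "distinct (x1 # x2 # y1 # y2 # X)"
        using True by auto
      ultimately have "?e12 \<or> ?e13 \<or> ?e23"
        using exch[of x1 x2 y2 y1] exch[of x1 x2 y1 y2] exch[of x1 y1 x2 y2] by argo
      then show ?thesis
        using nz by blast
    qed
  qed (rule assms(4) closed swap refl)+
  ultimately show ?thesis
    unfolding weak_matroid_def f_def[symmetric, abs_def] chi_def[symmetric] bases
    using closed by (auto simp: bases)
qed

end
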